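(* Let $(A,\mu)$ be an associative algebra, $(M,l_M,r_M)$ an $(A,\mu)$-bimodule and $P:M\to A$ a relative averaging operator, with corresponding Maurer-Cartan element $\alpha=(s^{-1}\Delta,P)\in(s^{-1}\mathfrak h\oplus\mathfrak a)_0$ as in the context. Let $\mu'\in\mathrm{Hom}(A^{\otimes2},A)$, $l'_M\in\mathrm{Hom}(A\otimes M,M)$, $r'_M\in\mathrm{Hom}(M\otimes A,M)$ and $P'\in\mathrm{Hom}(M,A)$ be linear maps. Then $(A,\mu+\mu')$ is an associative algebra, $(M,l_M+l'_M,r_M+r'_M)$ is a bimodule over it and $P+P':M\to A$ is a relative averaging operator (with respect to these structures) if and only if $\alpha'=(s^{-1}\Delta',P')$ is a Maurer-Cartan element of the twisted $L_\infty$-algebra $\big(s^{-1}\mathfrak h\oplus\mathfrak a,\{l_k^{(s^{-1}\Delta,P)}\}_{k=1}^\infty\big)$, where $\Delta'$ is defined from $\mu',l'_M,r'_M$ in the same way as $\Delta$ is defined from $\mu,l_M,r_M$.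
   Context: Everything is over a field $\mathbf k$ of characteristic $0$. Relative averaging operator: for an associative algebra $A$ and an $A$-bimodule $M$, a linear map $P:M\to A$ with $P(u)\cdot P(v)=P(P(u)\cdot_M v)=P(u\cdot_M P(v))$ for all $u,v\in M$ ($\cdot_M$ denotes both actions). Trees. $Y_n$ ($n\ge 1$) is the set of planar binary trees with $n$ trivalent vertices, one root and $n+1$ leaves labelled $0,1,\dots,n$ from left to right; $\vee$ is grafting at a new root vertex, $Y_1=\{|\vee|\}$, $Y_2=\{y_\dashv,y_\vdash\}$ with $y_\dashv=|\vee(|\vee|)$, $y_\vdash=(|\vee|)\vee|$. For $m,n\ge1$, $1\le i\le m$: $R_0^{m;i,n}:Y_{m+n-1}\to Y_m$ deletes the leaves labelled $i,\dots,i+n-2$, and $R_i^{m;i,n}:Y_{m+n-1}\to Y_n$ deletes the leaves labelled $0,\dots,i-2$ and $i+n,\dots,m+n-1$ (labels refer to the original tree). Majumdar-Mukherjee bracket. For a vector space $D$ put $CY^n(D,D)=\mathrm{Hom}(\mathbf k[Y_n]\otimes D^{\otimes n},D)$. For $f\in CY^m(D,D)$, $g\in CY^n(D,D)$, $m,n\geq 1$, $$(f\circ_i g)(y;a_1,\dots,a_{m+n-1})=f\big(R_0^{m;i,n}(y);a_1,\dots,a_{i-1},g(R_i^{m;i,n}(y);a_i,\dots,a_{i+n-1}),a_{i+n},\dots,a_{m+n-1}\big),$$ $$[f,g]_{\mathsf{MM}}=\sum_{i=1}^m(-1)^{(i-1)(n-1)}f\circ_i g-(-1)^{(m-1)(n-1)}\sum_{i=1}^n(-1)^{(i-1)(m-1)}g\circ_i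 f ,$$ a graded Lie bracket on $\oplus_{n\ge0}CY^{n+1}(D,D)$ with $CY^{n+1}(D,D)$ in degree $n$. Let $\mathfrak g=\oplus_{n\ge0}CY^{n+1}(A\oplus M,A\oplus M)$. Let $\mathcal A^{k,l}\subset(A\oplus M)^{\otimes(k+l)}$ be the direct sum of all tensor products of $k$ copies of $A$ and $l$ copies of $M$, in any order. $f\in CY^{n+1}(A\oplus M,A\oplus M)$ has bidegree $k|l$, $k+l=n$, if $f(\mathbf k[Y_{n+1}]\otimes\mathcal A^{k+1,l})\subset A$, $f(\mathbf k[Y_{n+1}]\otimes\mathcal A^{k,l+1})\subset M$ and $f=0$ otherwise; $CY^{k|l}$ is the space of these. $\mathfrak h=\oplus_{n\ge0}\mathfrak h_n$ with $\mathfrak h_n=CY^{n|0}$, and $\mathfrak a=\oplus_{n\ge0}\mathfrak a_n$ with $\mathfrak a_n=CY^{-1|n+1}\cong\mathrm{Hom}(\mathbf k[Y_{n+1}]\otimes M^{\otimes n+1},A)$. $p:\mathfrak g\to\mathfrak g$ is the projection onto $\mathfrak a$ (component with all inputs in $M$ and output in $A$). $(s^{-1}\mathfrak h)_k=\mathfrak h_{k+1}$. The $L_\infty$-algebra $s^{-1}\mathfrak h\oplus\mathfrak a$ (in the convention of degree $1$ graded symmetric operations $l_k$) has $l_2((s^{-1}f,0),(s^{-1}g,0))=((-1)^{|f|}s^{-1}[f,g]_{\mathsf{MM}},0)$ and $l_k((s^{-1}f,0),(0,h_1),\dots,(0,h_{k-1}))=(0,p[\cdots[[f,h_1]_{\mathsf{MM}},h_2]_{\mathsf{MM}},\dots,h_{k-1}]_{\mathsf{MM}})$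 for $k\ge2$, all other maps being zero up to permutation of the entries. A Maurer-Cartan element of an $L_\infty$-algebra $(L,\{l_k\})$ is $\alpha\in L_0$ with $\sum_{k\ge1}\frac1{k!}l_k(\alpha,\dots,\alpha)=0$. For such $\alpha$, the twisted $L_\infty$-algebra $(L,\{l_k^\alpha\})$ has $l_k^\alpha(x_1,\dots,x_k)=\sum_{n\ge0}\frac1{n!}l_{n+k}(\alpha,\dots,\alpha,x_1,\dots,x_k)$ ($n$ copies of $\alpha$). $\Delta\in\mathfrak h_1$ is given by $\Delta(y_\dashv;(a,u),(b,v))=(\mu(a,b),r_M(u,b))$ and $\Delta(y_\vdash;(a,u),(b,v))=(\mu(a,b),l_M(a,v))$; linear maps $M\to A$ are viewed in $\mathfrak a_0$ via $P(|\vee|;u)=P(u)$. *)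

theory Defs
  imports
    "HOL-Library.Function_Algebras"
    "HOL-Library.Groups_Big_Fun"
    "HOL-Analysis.Product_Vector"
begin

text \<open>
  Vector spaces are whole types with a scalar multiplication satisfying \<^locale>\<open>vector_space\<close>.
  Sums, negatives and zeros of functions and of pairs are the pointwise ones.
\<close>

section \<open>Associative algebras, bimodules, relative averaging operators\<close>

definition bilinear_map ::
  "('k::field \<Rightarrow> 'u::ab_group_add \<Rightarrow> 'u) \<Rightarrow> ('k \<Rightarrow> 'v::ab_group_add \<Rightarrow> 'v) \<Rightarrow>
   ('k \<Rightarrow> 'w::ab_group_add \<Rightarrow> 'w) \<Rightarrow> ('u \<Rightarrow> 'v \<Rightarrow> 'w) \<Rightarrow> bool"
  where "bilinear_map sU sV sW \<phi> \<longleftrightarrow>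
    (\<forall>u. Vector_Spaces.linear sV sW (\<lambda>v. \<phi> u v)) \<and>
    (\<forall>v. Vector_Spaces.linear sU sW (\<lambda>u. \<phi> u v))"

text \<open>Algebras are not assumed to be unital.\<close>

definition associative_algebra ::
  "('k::field \<Rightarrow> 'a::ab_group_add \<Rightarrow> 'a) \<Rightarrow> ('a \<Rightarrow> 'a \<Rightarrow> 'a) \<Rightarrow> bool"
  where "associative_algebra sA \<mu> \<longleftrightarrow>
    bilinear_map sA sA sA \<mu> \<and> (\<forall>a b c. \<mu> (\<mu> a b) c = \<mu> a (\<mu> b c))"

definition bimodule ::
  "('k::field \<Rightarrow> 'a::ab_group_add \<Rightarrow> 'a) \<Rightarrow> ('k \<Rightarrow> 'm::ab_group_add \<Rightarrow> 'm) \<Rightarrow>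
   ('a \<Rightarrow> 'a \<Rightarrow> 'a) \<Rightarrow> ('a \<Rightarrow> 'm \<Rightarrow> 'm) \<Rightarrow> ('m \<Rightarrow> 'a \<Rightarrow> 'm) \<Rightarrow> bool"
  where "bimodule sA sM \<mu> l r \<longleftrightarrow>
    bilinear_map sA sM sM l \<and> bilinear_map sM sA sM r \<and>
    (\<forall>a b u. l (\<mu> a b) u = l a (l b u)) \<and>
    (\<forall>a u b. r (l a u) b = l a (r u b)) \<and>
    (\<forall>u a b. r (r u a) b = r u (\<mu> a b))"

definition relative_averaging_operator ::
  "('k::field \<Rightarrow> 'a::ab_group_add \<Rightarrow> 'a) \<Rightarrow> ('k \<Rightarrow> 'm::ab_group_add \<Rightarrow> 'm) \<Rightarrow>
   ('a \<Rightarrow> 'a \<Rightarrow> 'a) \<Rightarrow> ('a \<Rightarrow> 'm \<Rightarrow> 'm) \<Rightarrow> ('m \<Rightarrow> 'a \<Rightarrow> 'm) \<Rightarrow> ('m \<Rightarrow> 'a) \<Rightarrow> bool"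
  where "relative_averaging_operator sA sM \<mu> l r P \<longleftrightarrow>
    Vector_Spaces.linear sM sA P \<and>
    (\<forall>u v. \<mu> (P u) (P v) = P (l (P u) v) \<and> \<mu> (P u) (P v) = P (r u (P v)))"


section \<open>Planar binary trees\<close>

datatype pbt = Leaf | Graft pbt pbt

fun vertices :: "pbt \<Rightarrow> nat" where
  "vertices Leaf = 0"
| "vertices (Graft s t) = vertices s + vertices t + 1"

definition Y :: "nat \<Rightarrow> pbt set"
  where "Y n = {t. vertices t = n}"

definition y_one :: pbt where "y_one = Graft Leaf Leaf"
definition y_left :: pbt where "y_left = Graft Leaf (Graft Leaf Leaf)"   \<comment> \<open>\<open>y\<^sub>\<stileturn>\<close>\<close>
definition y_right :: pbt where "y_right = Graft (Graft Leaf Leaf) Leaf"  \<comment> \<open>\<open>y\<^sub>\<turnstile>\<close>\<close>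

text \<open>
  \<open>prune S k t\<close> deletes from \<open>t\<close>, whose leaves carry the labels \<open>k, k + 1, \<dots>\<close> from left to right,
  the leaves with label in \<open>S\<close>, and suppresses the vertices that are no longer trivalent;
  the result is \<^const>\<open>None\<close> if no leaf is left.
\<close>

fun prune :: "nat set \<Rightarrow> nat \<Rightarrow> pbt \<Rightarrow> pbt option" where
  "prune S k Leaf = (if k \<in> S then None else Some Leaf)"
| "prune S k (Graft s t) =
    (case prune S k s of
       None \<Rightarrow> prune S (k + vertices s + 1) t
     | Some s' \<Rightarrow>
         (case prune S (k + vertices s + 1) t of
            None \<Rightarrow> Some s'
          | Some t' \<Rightarrow> Some (Graft s' t')))"

definition delete_leaves :: "nat set \<Rightarrow> pbt \<Rightarrow> pbt"
  where "delete_leaves S t = the (prune S 0 t)"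

text \<open>
  \<open>R_out m i n\<close> and \<open>R_in m i n\<close> are the maps \<open>R\<^sub>0\<close> and \<open>R\<^sub>i\<close> with upper index \<open>(m; i, n)\<close>.  The label
  ranges are half-open, so that no truncated subtraction below \<open>0\<close> occurs for \<open>i = 1\<close> or \<open>n = 1\<close>.
\<close>

definition R_out :: "nat \<Rightarrow> nat \<Rightarrow> nat \<Rightarrow> pbt \<Rightarrow> pbt"
  where "R_out m i n = delete_leaves {i..<i + n - 1}"

definition R_in :: "nat \<Rightarrow> nat \<Rightarrow> nat \<Rightarrow> pbt \<Rightarrow> pbt"
  where "R_in m i n = delete_leaves ({0..<i - 1} \<union> {i + n..<m + n})"


section \<open>Cochains and the Majumdar--Mukherjee bracket\<close>

text \<open>
  An element of \<open>Hom(k[Y\<^sub>n] \<otimes> D\<^sup>\<otimes>\<^sup>n, D)\<close> is given by its values \<open>f y [a\<^sub>1, \<dots>, a\<^sub>n]\<close> on the basis trees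
  \<open>y\<close> of \<open>k[Y\<^sub>n]\<close>, multilinear in \<open>a\<^sub>1, \<dots>, a\<^sub>n\<close>; outside \<open>Y\<^sub>n\<close> and lists of length \<open>n\<close> it is
  set to \<open>0\<close>, so that equality of functions is equality in \<open>CY\<^sup>n(D, D)\<close>.
\<close>

type_synonym 'd cochain = "pbt \<Rightarrow> 'd list \<Rightarrow> 'd"

definition CY :: "('k::field \<Rightarrow> 'd::ab_group_add \<Rightarrow> 'd) \<Rightarrow> nat \<Rightarrow> 'd cochain set"
  where "CY sD n = {f.
    (\<forall>y xs. y \<in> Y n \<and> length xs = n \<longrightarrow>
       (\<forall>i<n. Vector_Spaces.linear sD sD (\<lambda>v. f y (xs[i := v])))) \<and>
    (\<forall>y xs. \<not> (y \<in> Y n \<and> length xs = n) \<longrightarrow> f y xs = 0)}"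

text \<open>\<open>sgn_mult e x\<close> is \<open>(-1)\<^sup>e x\<close>.\<close>

definition sgn_mult :: "'i::semiring_parity \<Rightarrow> 'v::ab_group_add \<Rightarrow> 'v"
  where "sgn_mult e x = (if even e then x else - x)"

definition circ :: "nat \<Rightarrow> nat \<Rightarrow> nat \<Rightarrow> 'd::ab_group_add cochain \<Rightarrow> 'd cochain \<Rightarrow> 'd cochain"
  where "circ m n i f g = (\<lambda>y xs.
    if y \<in> Y (m + n - 1) \<and> length xs = m + n - 1
    then f (R_out m i n y)
           (take (i - 1) xs @ [g (R_in m i n y) (take n (drop (i - 1) xs))] @ drop (i - 1 + n) xs)
    else 0)"

definition MM_bracket :: "nat \<Rightarrow> nat \<Rightarrow> 'd::ab_group_add cochain \<Rightarrow> 'd cochain \<Rightarrow> 'd cochain"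
  where "MM_bracket m n f g =
    (\<Sum>i=1..m. sgn_mult ((i - 1) * (n - 1)) (circ m n i f g)) -
    sgn_mult ((m - 1) * (n - 1)) (\<Sum>i=1..n. sgn_mult ((i - 1) * (m - 1)) (circ n m i g f))"


section \<open>The graded Lie algebra of cochains\<close>

text \<open>
  An element of a direct sum of cochain spaces indexed by degrees \<open>d \<in> \<int>\<close> is the function that
  assigns to \<open>d\<close> its component in degree \<open>d\<close>.
\<close>

type_synonym 'd gcochain = "int \<Rightarrow> 'd cochain"

definition in_degree :: "int \<Rightarrow> 'd::ab_group_add cochain \<Rightarrow> 'd gcochain"
  where "in_degree d f = (\<lambda>e. if e = d then f else 0)"

text \<open>The component of degree \<open>d\<close> lies in \<open>CY\<^sup>d\<^sup>+\<^sup>1\<close>; degrees are nonnegative.\<close>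

definition bracket :: "'d::ab_group_add gcochain \<Rightarrow> 'd gcochain \<Rightarrow> 'd gcochain"
  where "bracket F G = (\<lambda>d. \<Sum>i=0..d. MM_bracket (nat i + 1) (nat (d - i) + 1) (F i) (G (d - i)))"

text \<open>\<open>(s\<^sup>-\<^sup>1 F)\<^sub>k = F\<^sub>k\<^sub>+\<^sub>1\<close>, and its inverse.\<close>

definition desusp :: "'d gcochain \<Rightarrow> 'd gcochain"
  where "desusp F = (\<lambda>k. F (k + 1))"

definition susp :: "'d gcochain \<Rightarrow> 'd gcochain"
  where "susp F = (\<lambda>k. F (k - 1))"


section \<open>Bidegrees for \<open>D = A \<oplus> M\<close>\<close>

definition A_part :: "('a::zero \<times> 'm::zero) set"
  where "A_part = {x. snd x = 0}"

definition M_part :: "('a::zero \<times> 'm::zero) set"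
  where "M_part = {x. fst x = 0}"

text \<open>
  \<open>mixed k l\<close> consists of the lists \<open>[x\<^sub>1, \<dots>, x\<^sub>k\<^sub>+\<^sub>l]\<close> whose tensors \<open>x\<^sub>1 \<otimes> \<cdots> \<otimes> x\<^sub>k\<^sub>+\<^sub>l\<close> span
  \<open>\<A>\<^sup>k\<^sup>,\<^sup>l\<close>: the entries at \<open>k\<close> positions (those in \<open>S\<close>) are in \<open>A\<close>, the others in \<open>M\<close>.
  It is empty if \<open>k < 0\<close> or \<open>l < 0\<close>.
\<close>

definition mixed :: "int \<Rightarrow> int \<Rightarrow> ('a::zero \<times> 'm::zero) list set"
  where "mixed k l = {xs. \<exists>S \<subseteq> {..<length xs}.
    int (card S) = k \<and> int (length xs) = k + l \<and>
    (\<forall>i<length xs. xs ! i \<in> (if i \<in> S then A_part else M_part))}"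

definition CY_bideg ::
  "('k::field \<Rightarrow> 'a::ab_group_add \<Rightarrow> 'a) \<Rightarrow> ('k \<Rightarrow> 'm::ab_group_add \<Rightarrow> 'm) \<Rightarrow>
   int \<Rightarrow> int \<Rightarrow> ('a \<times> 'm) cochain set"
  where "CY_bideg sA sM k l = {f \<in> CY (module_prod.scale sA sM) (nat (k + l + 1)).
    \<forall>y. (\<forall>xs \<in> mixed (k + 1) l. f y xs \<in> A_part) \<and>
        (\<forall>xs \<in> mixed k (l + 1). f y xs \<in> M_part) \<and>
        (\<forall>k' l'. (k', l') \<noteq> (k + 1, l) \<and> (k', l') \<noteq> (k, l + 1) \<longrightarrow>
           (\<forall>xs \<in> mixed k' l'. f y xs = 0))}"

definition h_space ::
  "('k::field \<Rightarrow> 'a::ab_group_add \<Rightarrow> 'a) \<Rightarrow> ('k \<Rightarrow> 'm::ab_group_add \<Rightarrow> 'm) \<Rightarrow>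
   int \<Rightarrow> ('a \<times> 'm) cochain set"
  where "h_space sA sM n = (if n \<ge> 0 then CY_bideg sA sM n 0 else {0})"

definition a_space ::
  "('k::field \<Rightarrow> 'a::ab_group_add \<Rightarrow> 'a) \<Rightarrow> ('k \<Rightarrow> 'm::ab_group_add \<Rightarrow> 'm) \<Rightarrow>
   int \<Rightarrow> ('a \<times> 'm) cochain set"
  where "a_space sA sM n = (if n \<ge> 0 then CY_bideg sA sM (- 1) (n + 1) else {0})"

definition proj_a :: "('a::ab_group_add \<times> 'm::ab_group_add) gcochain \<Rightarrow> ('a \<times> 'm) gcochain"
  where "proj_a F = (\<lambda>d y xs. (fst (F d y (map (\<lambda>x. (0, snd x)) xs)), 0))"


section \<open>The \<open>L\<^sub>\<infinity>\<close>-algebra on \<open>s\<^sup>-\<^sup>1 h \<oplus> a\<close>\<close>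

text \<open>An element is a pair of its component in \<open>s\<^sup>-\<^sup>1 h\<close> and its component in \<open>a\<close>.\<close>

type_synonym ('a, 'm) Lelem = "('a \<times> 'm) gcochain \<times> ('a \<times> 'm) gcochain"

definition L_scale ::
  "('k::field \<Rightarrow> 'a::ab_group_add \<Rightarrow> 'a) \<Rightarrow> ('k \<Rightarrow> 'm::ab_group_add \<Rightarrow> 'm) \<Rightarrow>
   'k \<Rightarrow> ('a, 'm) Lelem \<Rightarrow> ('a, 'm) Lelem"
  where "L_scale sA sM c x =
    ((\<lambda>d y xs. module_prod.scale sA sM c (fst x d y xs)),
     (\<lambda>d y xs. module_prod.scale sA sM c (snd x d y xs)))"

definition L_degree ::
  "('k::field \<Rightarrow> 'a::ab_group_add \<Rightarrow> 'a) \<Rightarrow> ('k \<Rightarrow> 'm::ab_group_add \<Rightarrow> 'm) \<Rightarrow>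
   int \<Rightarrow> ('a, 'm) Lelem set"
  where "L_degree sA sM d =
    {(desusp (in_degree (d + 1) f), in_degree d h) | f h.
       f \<in> h_space sA sM (d + 1) \<and> h \<in> a_space sA sM d}"

definition L_component :: "int \<Rightarrow> ('a::ab_group_add, 'm::ab_group_add) Lelem \<Rightarrow> ('a, 'm) Lelem"
  where "L_component d x = (in_degree d (fst x d), in_degree d (snd x d))"

text \<open>
  \<open>l_homogeneous [d\<^sub>1, \<dots>, d\<^sub>k] [x\<^sub>1, \<dots>, x\<^sub>k]\<close> is \<open>l\<^sub>k(x\<^sub>1, \<dots>, x\<^sub>k)\<close> for homogeneous
  \<open>x\<^sub>j = (s\<^sup>-\<^sup>1 f\<^sub>j, h\<^sub>j)\<close> of degree \<open>d\<^sub>j\<close>, so that \<open>|f\<^sub>j| = d\<^sub>j + 1\<close>.  Expanding by multilinearity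
  leaves, besides \<open>l\<^sub>2((s\<^sup>-\<^sup>1 f\<^sub>1, 0), (s\<^sup>-\<^sup>1 f\<^sub>2, 0))\<close>, the terms in which exactly one argument, the one at
  (zero-based) position \<open>i\<close>, is taken from \<open>s\<^sup>-\<^sup>1 h\<close>.  By graded symmetry that argument is moved to the
  front past all arguments before it, with Koszul sign \<open>(-1)\<close> to the power
  \<open>d\<^sub>i\<close> times the sum of their degrees.
\<close>

definition l_homogeneous ::
  "int list \<Rightarrow> ('a::ab_group_add, 'm::ab_group_add) Lelem list \<Rightarrow> ('a, 'm) Lelem"
  where "l_homogeneous ds xs =
    (if length xs < 2 then 0 else
       (if length xs = 2
        then (sgn_mult (ds ! 0 + 1)
                (desusp (bracket (susp (fst (xs ! 0))) (susp (fst (xs ! 1))))), 0)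
        else 0) +
       (\<Sum>i<length xs.
          (0, sgn_mult (ds ! i * sum_list (take i ds))
                (proj_a (foldl bracket (susp (fst (xs ! i)))
                           (map snd (take i xs @ drop (Suc i) xs)))))))"

text \<open>
  Multilinear extension to sums of homogeneous elements; the argument is the list of the \<open>k\<close>
  arguments of \<open>l\<^sub>k\<close>.  The sum runs over all ways of choosing one nonzero homogeneous component of
  each argument.
\<close>

definition l_ops :: "('a::ab_group_add, 'm::ab_group_add) Lelem list \<Rightarrow> ('a, 'm) Lelem"
  where "l_ops xs =
    (\<Sum>ds \<in> {ds. length ds = length xs \<and> (\<forall>i<length xs. L_component (ds ! i) (xs ! i) \<noteq> 0)}.
       l_homogeneous ds (map2 L_component ds xs))"


section \<open>Maurer--Cartan elements and twisting\<close>

text \<open>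
  A family \<open>{l\<^sub>k}\<close> is a single function on lists, \<open>l\<^sub>k\<close> being its restriction to lists of length \<open>k\<close>.
  \<open>L0\<close> is the degree \<open>0\<close> part.  There is no topology: the Maurer--Cartan sum has to have finitely
  many nonzero terms.
\<close>

definition maurer_cartan ::
  "('k::field_char_0 \<Rightarrow> 'l::ab_group_add \<Rightarrow> 'l) \<Rightarrow> 'l set \<Rightarrow> ('l list \<Rightarrow> 'l) \<Rightarrow> 'l \<Rightarrow> bool"
  where "maurer_cartan sL L0 l \<alpha> \<longleftrightarrow>
    \<alpha> \<in> L0 \<and>
    finite {k. k \<ge> 1 \<and> sL (1 / fact k) (l (replicate k \<alpha>)) \<noteq> 0} \<and>
    (\<Sum>k | k \<ge> 1 \<and> sL (1 / fact k) (l (replicate k \<alpha>)) \<noteq> 0.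
       sL (1 / fact k) (l (replicate k \<alpha>))) = 0"

text \<open>
  For \<^const>\<open>l_ops\<close> the sum below always has finitely many nonzero terms: if \<open>f \<in> h\<^sub>m\<close>, then
  \<open>p[\<dots>[f, h\<^sub>1], \<dots>, h\<^sub>N]\<close> vanishes unless \<open>N = m + 1\<close>.
\<close>

definition twisted ::
  "('k::field_char_0 \<Rightarrow> 'l::ab_group_add \<Rightarrow> 'l) \<Rightarrow> ('l list \<Rightarrow> 'l) \<Rightarrow> 'l \<Rightarrow> 'l list \<Rightarrow> 'l"
  where "twisted sL l \<alpha> xs = Sum_any (\<lambda>n. sL (1 / fact n) (l (replicate n \<alpha> @ xs)))"


section \<open>The elements \<open>\<Delta>\<close> and \<open>P\<close>\<close>

definition Delta ::
  "('a::ab_group_add \<Rightarrow> 'a \<Rightarrow> 'a) \<Rightarrow> ('a \<Rightarrow> 'm::ab_group_add \<Rightarrow> 'm) \<Rightarrow> ('m \<Rightarrow> 'a \<Rightarrow> 'm) \<Rightarrow>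
   ('a \<times> 'm) cochain"
  where "Delta \<mu> l r = (\<lambda>y xs. case xs of
      [(a, u), (b, v)] \<Rightarrow>
        if y = y_left then (\<mu> a b, r u b)
        else if y = y_right then (\<mu> a b, l a v)
        else 0
    | _ \<Rightarrow> 0)"

definition operator_cochain ::
  "('m::ab_group_add \<Rightarrow> 'a::ab_group_add) \<Rightarrow> ('a \<times> 'm) cochain"
  where "operator_cochain P = (\<lambda>y xs. case xs of
      [(a, u)] \<Rightarrow> if y = y_one then (P u, 0) else 0
    | _ \<Rightarrow> 0)"

text \<open>The pair \<open>(s\<^sup>-\<^sup>1 \<Delta>, P)\<close>.\<close>

definition structure_element ::
  "('a::ab_group_add \<Rightarrow> 'a \<Rightarrow> 'a) \<Rightarrow> ('a \<Rightarrow> 'm::ab_group_add \<Rightarrow> 'm) \<Rightarrow> ('m \<Rightarrow> 'a \<Rightarrow> 'm) \<Rightarrow>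
   ('m \<Rightarrow> 'a) \<Rightarrow> ('a, 'm) Lelem"
  where "structure_element \<mu> l r P =
    (desusp (in_degree 1 (Delta \<mu> l r)), in_degree 0 (operator_cochain P))"

end

theory Submission
  imports Defs
begin

text \<open>
  For \<open>D = (\<mu>, l, r, P)\<close> with \<open>\<alpha> = (s\<^sup>-\<^sup>1 \<Delta>, P)\<close>, the Maurer--Cartan expression \<open>\<Sum> l\<^sub>k(\<alpha>, \<dots>, \<alpha>) / k!\<close>,
  called the curvature of \<open>D\<close> below, only has the terms \<open>- s\<^sup>-\<^sup>1 [\<Delta>, \<Delta>] / 2\<close> and
  \<open>[[\<Delta>, P], P] / 2\<close>: the double bracket lies in the abelian subalgebra \<open>a\<close>, so all longer brackets
  vanish.  On the five trees of \<open>Y\<^sub>3\<close> the first term gives the dialgebra axioms for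
  \<open>A \<oplus> M\<close>, which are associativity of \<open>\<mu>\<close> and the bimodule axioms, and on the two trees
  of \<open>Y\<^sub>2\<close> the second gives the two averaging identities.  By multilinearity the Maurer--Cartan
  expression of the twisted algebra at \<open>\<alpha>'\<close> is the curvature of \<open>D + D'\<close> minus that of \<open>D\<close>, and
  the latter is zero.
\<close>

section \<open>Planar binary trees with at most three vertices\<close>

lemma vertices_eq_0_iff: "vertices t = 0 \<longleftrightarrow> t = Leaf"
  by (cases t) auto

lemma vertices_eq_1_iff: "vertices t = Suc 0 \<longleftrightarrow> t = y_one"
  by (cases t) (auto simp: vertices_eq_0_iff y_one_def)

lemma vertices_eq_2_iff: "vertices t = Suc (Suc 0) \<longleftrightarrow> t = y_left \<or> t = y_right"
proof (cases t)
  case (Graft t1 t2)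
  have "m + n = Suc 0 \<longleftrightarrow> m = 0 \<and> n = Suc 0 \<or> m = Suc 0 \<and> n = 0" for m n :: nat
    by arith
  with Graft show ?thesis
    by (simp add: vertices_eq_0_iff vertices_eq_1_iff y_one_def y_left_def y_right_def)
qed (simp add: y_left_def y_right_def)

lemma vertices_eq_3_iff:
  "vertices t = Suc (Suc (Suc 0)) \<longleftrightarrow>
    t = Graft Leaf y_left \<or> t = Graft Leaf y_right \<or> t = Graft y_one y_one \<or>
    t = Graft y_left Leaf \<or> t = Graft y_right Leaf"
proof (cases t)
  case (Graft t1 t2)
  have "m + n = Suc (Suc 0) \<longleftrightarrow>
      m = 0 \<and> n = Suc (Suc 0) \<or> m = Suc 0 \<and> n = Suc 0 \<or> m = Suc (Suc 0) \<and> n = 0"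
    for m n :: nat
    by arith
  with Graft show ?thesis
    by (auto simp: vertices_eq_0_iff vertices_eq_1_iff vertices_eq_2_iff)
qed simp

lemma Y_1: "y \<in> Y (Suc 0) \<longleftrightarrow> y = y_one"
  by (simp add: Y_def vertices_eq_1_iff)

lemma Y_2: "y \<in> Y 2 \<longleftrightarrow> y = y_left \<or> y = y_right"
  by (simp add: Y_def numeral_2_eq_2 vertices_eq_2_iff)

lemma Y_3:
  "y \<in> Y 3 \<longleftrightarrow>
    y = Graft Leaf y_left \<or> y = Graft Leaf y_right \<or> y = Graft y_one y_one \<or>
    y = Graft y_left Leaf \<or> y = Graft y_right Leaf"
  by (simp add: Y_def numeral_3_eq_3 vertices_eq_3_iff)

lemma y_left_neq_y_right [simp]: "y_left \<noteq> y_right" "y_right \<noteq> y_left"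
  by (simp_all add: y_left_def y_right_def)

lemma length_eq_2_iff: "length xs = 2 \<longleftrightarrow> (\<exists>x z. xs = [x, z])"
  by (auto simp: numeral_2_eq_2 length_Suc_conv)

lemma length_eq_3_iff: "length xs = 3 \<longleftrightarrow> (\<exists>x y z. xs = [x, y, z])"
  by (auto simp: numeral_3_eq_3 length_Suc_conv)

section \<open>Signs, degree shifts and brackets of homogeneous cochains\<close>

lemma sgn_mult_zero [simp]: "sgn_mult e 0 = 0"
  by (simp add: sgn_mult_def)

lemma in_degree_zero [simp]: "in_degree d 0 = 0"
  by (auto simp: in_degree_def)

lemma in_degree_add: "in_degree d (f + g) = in_degree d f + in_degree d g"
  by (auto simp: in_degree_def)

lemma in_degree_eq_0_iff [simp]: "in_degree d f = 0 \<longleftrightarrow> f = 0"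
  by (metis in_degree_def in_degree_zero)

lemma susp_desusp [simp]: "susp (desusp F) = F"
  by (simp add: susp_def desusp_def)

lemma desusp_zero [simp]: "desusp 0 = 0"
  by (simp add: desusp_def zero_fun_def)

lemma desusp_add: "desusp (F + G) = desusp F + desusp G"
  by (simp add: desusp_def plus_fun_def)

lemma desusp_eq_0_iff [simp]: "desusp F = 0 \<longleftrightarrow> F = 0"
  by (metis susp_desusp desusp_zero)

lemma proj_a_zero [simp]: "proj_a 0 = 0"
  by (intro ext) (simp add: proj_a_def zero_prod_def)

text \<open>
  All that remains of multilinearity in the computation of brackets; it makes \<open>f\<close> composed with a
  zero cochain vanish, so that homogeneous elements only contribute in one degree.
\<close>

definition normalized :: "'d::ab_group_add cochain \<Rightarrow> bool"
  where "normalized f \<longleftrightarrow> (\<forall>y xs. 0 \<in> set xs \<longrightarrow> f y xs = 0)"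

lemma circ_zero_left [simp]: "circ m n i 0 g = 0"
  by (intro ext) (simp add: circ_def)

lemma circ_zero_right: "normalized f \<Longrightarrow> circ m n i f 0 = 0"
  by (intro ext) (simp add: circ_def normalized_def)

lemma MM_bracket_zero_left: "normalized g \<Longrightarrow> MM_bracket m n 0 g = 0"
  by (simp add: MM_bracket_def circ_zero_right)

lemma MM_bracket_zero_right: "normalized f \<Longrightarrow> MM_bracket m n f 0 = 0"
  by (simp add: MM_bracket_def circ_zero_right)

text \<open>Any splitting of the degree other than \<open>p + q\<close> feeds a zero cochain into
  the bracket. Composing with zero on the right inserts the vector 0 as an input, which is where
  \<open>normalized\<close> enters.\<close>

lemma bracket_in_degree:
  assumes "normalized f" and "normalized g"
  shows "bracket (in_degree (int p) f) (in_degree (int q) g) =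
    in_degree (int (p + q)) (MM_bracket (p + 1) (q + 1) f g)"
proof
  fix d
  \<comment> \<open>The two tests are nested so that the sum over \<open>i\<close> collapses to the
    single index \<open>p\<close>; when \<open>d = p + q\<close>, this index does lie in
    \<open>{0..d}\<close>.\<close>
  have "MM_bracket (nat i + 1) (nat (d - i) + 1) (in_degree (int p) f i) (in_degree (int q) g (d - i)) =
      (if i = int p then if d = int (p + q) then MM_bracket (p + 1) (q + 1) f g else 0 else 0)" for i
  proof (cases "i = int p \<and> d - i = int q")
    case True
    then have i: "i = int p" "d = int p + int q"
      by simp_all
    have "nat (int p) = p" "nat (int p + int q - int p) = q" "int p + int q - int p = int q"
      by simp_all
    then show ?thesis
      unfolding i in_degree_def by simp
  next
    case False
    then have "in_degree (int p) f i = 0 \<or> in_degree (int q) g (d - i) = 0"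
      by (auto simp: in_degree_def)
    moreover have "normalized (in_degree (int p) f i)" "normalized (in_degree (int q) g (d - i))"
      using assms by (simp_all add: in_degree_def normalized_def)
    ultimately have "MM_bracket (nat i + 1) (nat (d - i) + 1) (in_degree (int p) f i)
        (in_degree (int q) g (d - i)) = 0"
      by (metis MM_bracket_zero_left MM_bracket_zero_right)
    with False show ?thesis
      by auto
  qed
  then have "bracket (in_degree (int p) f) (in_degree (int q) g) d =
      (\<Sum>i=0..d. if i = int p then if d = int (p + q) then MM_bracket (p + 1) (q + 1) f g else 0 else 0)"
    unfolding bracket_def by simp
  also have "\<dots> = in_degree (int (p + q)) (MM_bracket (p + 1) (q + 1) f g) d"
    by (simp add: in_degree_def)
  finally show "bracket (in_degree (int p) f) (in_degree (int q) g) d =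
    in_degree (int (p + q)) (MM_bracket (p + 1) (q + 1) f g) d" .
qed

section \<open>Brackets with a linear map from M to A\<close>

definition lift_op :: "('m \<Rightarrow> 'a) \<Rightarrow> 'a \<times> 'm \<Rightarrow> 'a \<times> 'm::zero"
  where "lift_op P x = (P (snd x), 0)"

text \<open>Closed form of the bracket of a binary cochain with an operator: the failure of
  \<open>lift_op P\<close> to be a derivation of each product. For additive operators two lifts
  compose to zero, since a lift reads the M-component and its values have none.\<close>

definition op_bracket ::
  "('a::ab_group_add \<times> 'm::ab_group_add) cochain \<Rightarrow> ('m \<Rightarrow> 'a) \<Rightarrow> ('a \<times> 'm) cochain"
  where "op_bracket f P = (\<lambda>y xs. case xs of
      [x, z] \<Rightarrow> if y \<in> Y 2
        then f y [lift_op P x, z] + f y [x, lift_op P z] - lift_op P (f y [x, z])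
        else 0
    | _ \<Rightarrow> 0)"

lemma operator_cochain_Cons [simp]:
  "operator_cochain P y [x] = (if y = y_one then lift_op P x else 0)"
  by (cases x) (simp add: operator_cochain_def lift_op_def)

lemma normalized_operator_cochain: "P 0 = 0 \<Longrightarrow> normalized (operator_cochain P)"
  by (auto simp: normalized_def operator_cochain_def zero_prod_def split: list.split)

text \<open>Inserting a unary operation deletes no leaf of the outer tree, its range
  \<open>{i..<i}\<close> being empty; the inner tree keeps two leaves. With the roles exchanged, the
  outer tree keeps two leaves and the inner one all three.\<close>

lemma R_binary_unary:
  assumes "y \<in> Y 2"
  shows "R_out 2 i 1 y = y" "R_in 2 1 1 y = y_one" "R_in 2 2 1 y = y_one"
    "R_out 1 1 2 y = y_one" "R_in 1 1 2 y = y"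
  using assms unfolding Y_2
  by (auto simp: R_out_def R_in_def delete_leaves_def y_left_def y_right_def y_one_def)

lemma MM_bracket_operator_cochain:
  "MM_bracket 2 1 f (operator_cochain P) = op_bracket f P"
proof (intro ext)
  fix y and xs :: "('a \<times> 'b) list"
  \<comment> \<open>All signs are trivial: each exponent contains the factor
    \<open>n - 1 = 0\<close> or, in the last sum, \<open>i - 1 = 0\<close>.\<close>
  have "MM_bracket 2 1 f (operator_cochain P) =
      circ 2 1 1 f (operator_cochain P) + circ 2 1 2 f (operator_cochain P)
      - circ 1 2 1 (operator_cochain P) f"
    by (simp add: MM_bracket_def sgn_mult_def numeral_2_eq_2)
  moreover have "(circ 2 1 1 f (operator_cochain P) + circ 2 1 2 f (operator_cochain P)
      - circ 1 2 1 (operator_cochain P) f) y xs = op_bracket f P y xs"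
  proof (cases "y \<in> Y 2 \<and> length xs = 2")
    case True
    then obtain x z where xs: "xs = [x, z]"
      by (auto simp: length_eq_2_iff)
    from True show ?thesis
      by (simp add: xs circ_def op_bracket_def R_binary_unary [simplified] flip: numeral_2_eq_2)
  next
    case False
    then show ?thesis
      by (auto simp: circ_def op_bracket_def split: list.split simp flip: numeral_2_eq_2)
  qed
  ultimately show "MM_bracket 2 1 f (operator_cochain P) y xs = op_bracket f P y xs"
    by simp
qed

text \<open>Both arguments have odd degree 1, so the outer sign turns the difference into a sum and
  the bracket is symmetric.\<close>

lemma MM_bracket_2_2:
  "MM_bracket 2 2 f g =
    (circ 2 2 1 f g - circ 2 2 2 f g) + (circ 2 2 1 g f - circ 2 2 2 g f)"
  by (simp add: MM_bracket_def sgn_mult_def numeral_2_eq_2)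

section \<open>Structure data and their iterated brackets\<close>

type_synonym ('a, 'm) datum =
  "('a \<Rightarrow> 'a \<Rightarrow> 'a) \<times> ('a \<Rightarrow> 'm \<Rightarrow> 'm) \<times> ('m \<Rightarrow> 'a \<Rightarrow> 'm) \<times> ('m \<Rightarrow> 'a)"

text \<open>Tuples add componentwise, so \<open>D + D'\<close> is the deformed structure. Only
  linearity is demanded, because the deforming part satisfies no identities by itself.\<close>

definition linear_datum ::
  "('k::field \<Rightarrow> 'a::ab_group_add \<Rightarrow> 'a) \<Rightarrow> ('k \<Rightarrow> 'm::ab_group_add \<Rightarrow> 'm) \<Rightarrow>
   ('a, 'm) datum \<Rightarrow> bool"
  where "linear_datum sA sM D \<longleftrightarrow> (case D of (\<mu>, l, r, P) \<Rightarrow>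
    bilinear_map sA sA sA \<mu> \<and> bilinear_map sA sM sM l \<and> bilinear_map sM sA sM r \<and>
    Vector_Spaces.linear sM sA P)"

definition Delta_of :: "('a::ab_group_add, 'm::ab_group_add) datum \<Rightarrow> ('a \<times> 'm) cochain"
  where "Delta_of D = (case D of (\<mu>, l, r, P) \<Rightarrow> Delta \<mu> l r)"

definition op_of :: "('a, 'm) datum \<Rightarrow> 'm \<Rightarrow> 'a"
  where "op_of D = snd (snd (snd D))"

text \<open>\<open>structure_element\<close> as a function of the whole tuple, so that it can be
  mapped over lists of arguments.\<close>

definition element_of :: "('a::ab_group_add, 'm::ab_group_add) datum \<Rightarrow> ('a, 'm) Lelem"
  where "element_of D =
    (desusp (in_degree 1 (Delta_of D)), in_degree 0 (operator_cochain (op_of D)))"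

lemma bilinear_map_zero:
  assumes "bilinear_map sU sV sW \<phi>"
  shows "\<phi> 0 v = 0" "\<phi> u 0 = 0"
  using assms additive.zero[of "\<phi> u"] additive.zero[of "\<lambda>u. \<phi> u v"]
  by (auto simp: bilinear_map_def Vector_Spaces.linear_iff additive_def)

lemma bilinear_map_add:
  assumes "bilinear_map sU sV sW \<phi>"
  shows "\<phi> (u + u') v = \<phi> u v + \<phi> u' v" "\<phi> u (v + v') = \<phi> u v + \<phi> u v'"
  using assms by (auto simp: bilinear_map_def Vector_Spaces.linear_iff)

lemma linear_zero_add:
  assumes "Vector_Spaces.linear sM sA P"
  shows "P 0 = 0" "P (u + v) = P u + P v" "P (u - v) = P u - P v"
proof -
  interpret module_hom sM sA P
    using assms by (simp add: linear_iff_module_hom)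
  show "P 0 = 0" "P (u + v) = P u + P v" "P (u - v) = P u - P v"
    by (simp_all add: add diff)
qed

lemma linear_datum_cases:
  assumes "linear_datum sA sM D"
  obtains \<mu> l r P where "D = (\<mu>, l, r, P)" "bilinear_map sA sA sA \<mu>" "bilinear_map sA sM sM l"
    "bilinear_map sM sA sM r" "Vector_Spaces.linear sM sA P"
  using assms by (auto simp: linear_datum_def split: prod.splits)

lemma normalized_Delta_of:
  assumes "linear_datum sA sM D"
  shows "normalized (Delta_of D)"
  using assms
  by (rule linear_datum_cases)
    (auto simp: normalized_def Delta_of_def Delta_def zero_prod_def bilinear_map_zero split: list.split)

lemma op_of_linear: "linear_datum sA sM D \<Longrightarrow> Vector_Spaces.linear sM sA (op_of D)"
  by (auto simp: linear_datum_def op_of_def)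

lemma op_of_zero: "linear_datum sA sM D \<Longrightarrow> op_of D 0 = 0"
  by (rule linear_zero_add(1)) (rule op_of_linear)

lemma normalized_op_bracket:
  assumes "normalized f" and "P 0 = 0"
  shows "normalized (op_bracket f P)"
  using assms
  by (auto simp: normalized_def op_bracket_def lift_op_def zero_prod_def split: list.split)

lemma op_bracket_zero_left: "P 0 = 0 \<Longrightarrow> op_bracket 0 P = 0"
  by (intro ext) (simp add: op_bracket_def lift_op_def zero_prod_def split: list.split)

lemma op_bracket_zero_right: "normalized f \<Longrightarrow> op_bracket f 0 = 0"
  by (intro ext) (simp add: op_bracket_def lift_op_def normalized_def zero_prod_def split: list.split)

lemma foldl_op_bracket_zero:
  "\<forall>P\<in>set Ps. P 0 = 0 \<Longrightarrow> foldl op_bracket 0 Ps = 0"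
  by (induction Ps) (simp_all add: op_bracket_zero_left)

text \<open>The accumulated cochain stays normalized until the zero operator is reached; from then
  on it is 0.\<close>

lemma foldl_op_bracket_zero_mem:
  assumes "normalized f" and "\<forall>P\<in>set Ps. P 0 = 0" and "0 \<in> set Ps"
  shows "foldl op_bracket f Ps = 0"
  using assms
proof (induction Ps arbitrary: f)
  case (Cons P Ps)
  then show ?case
    by (cases "P = 0")
      (auto simp: op_bracket_zero_right foldl_op_bracket_zero normalized_op_bracket)
qed simp

text \<open>An operator has degree 0, so every step stays in degree 1 and on binary cochains, where
  \<open>op_bracket\<close> computes the bracket.\<close>

lemma foldl_bracket_operator_cochain:
  assumes "normalized f" and "\<forall>P\<in>set Ps. P 0 = 0"
  shows "foldl bracket (in_degree 1 f) (map (\<lambda>P. in_degree 0 (operator_cochain P)) Ps) =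
    in_degree 1 (foldl op_bracket f Ps)"
  using assms
proof (induction Ps arbitrary: f)
  case (Cons P Ps)
  have "bracket (in_degree 1 f) (in_degree 0 (operator_cochain P)) = in_degree 1 (op_bracket f P)"
    using bracket_in_degree[of f "operator_cochain P" 1 0] Cons.prems
      MM_bracket_operator_cochain[of f P]
    by (simp add: normalized_operator_cochain numeral_2_eq_2)
  with Cons show ?case
    by (simp add: normalized_op_bracket)
qed simp

text \<open>Each bracket with an operator shifts the bidegree by \<open>-1|1\<close>. Starting from
  \<open>1|0\<close>, the third one would land in \<open>-2|3\<close>, where only the zero cochain
  lives.\<close>

lemma op_bracket_Delta_thrice:
  assumes "linear_datum sA sM D" and "Vector_Spaces.linear sM sA P" and "Vector_Spaces.linear sM sA Q"
    and "Vector_Spaces.linear sM sA R"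
  shows "op_bracket (op_bracket (op_bracket (Delta_of D) P) Q) R = 0"
  using assms(1)
proof (rule linear_datum_cases)
  fix \<mu> l r P'
  assume D: "D = (\<mu>, l, r, P')" "bilinear_map sA sA sA \<mu>" "bilinear_map sA sM sM l"
    "bilinear_map sM sA sM r"
  show ?thesis
    by (intro ext)
      (auto simp: op_bracket_def lift_op_def Delta_of_def D Delta_def Y_2
        zero_prod_def bilinear_map_zero[OF D(2)] bilinear_map_zero[OF D(3)] bilinear_map_zero[OF D(4)]
        linear_zero_add[OF assms(2)] linear_zero_add[OF assms(3)] linear_zero_add[OF assms(4)]
        split: list.split)
qed

lemma foldl_op_bracket_ge_3:
  assumes "linear_datum sA sM D" and "\<forall>P\<in>set Ps. Vector_Spaces.linear sM sA P" and "length Ps \<ge> 3"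
  shows "foldl op_bracket (Delta_of D) Ps = 0"
proof -
  obtain P Q R Ps' where Ps: "Ps = P # Q # R # Ps'"
    using assms(3) by (metis Suc_le_length_iff numeral_3_eq_3)
  moreover have "\<forall>P\<in>set Ps. P 0 = 0"
    using assms(2) by (blast dest: linear_zero_add(1))
  ultimately show ?thesis
    using assms by (simp add: op_bracket_Delta_thrice foldl_op_bracket_zero)
qed

text \<open>
  \<open>p [[\<Delta>, P], Q]\<close> is the symmetrisation of this expression in \<open>P\<close> and \<open>Q\<close>.  It is trilinear in
  \<open>\<Delta>\<close>, \<open>P\<close>, \<open>Q\<close>, and at \<open>P = Q\<close> it is the failure of the averaging identities.
\<close>

definition averaging_defect ::
  "('a::ab_group_add \<times> 'm::ab_group_add) cochain \<Rightarrow> ('m \<Rightarrow> 'a) \<Rightarrow> ('m \<Rightarrow> 'a) \<Rightarrow> ('a \<times> 'm) cochain"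
  where "averaging_defect f P Q = (\<lambda>y xs. case xs of
      [x, z] \<Rightarrow> if y \<in> Y 2
        then (fst (f y [lift_op P x, lift_op Q z]) - P (snd (f y [(0, snd x), lift_op Q z]))
          - P (snd (f y [lift_op Q x, (0, snd z)])), 0)
        else 0
    | _ \<Rightarrow> 0)"

text \<open>The bracket has bidegree \<open>0|1\<close>, so two inputs from M produce an output in
  M. Hence operators contribute nothing to the binary operation.\<close>

lemma proj_a_op_bracket_Delta:
  assumes "linear_datum sA sM D" and "Vector_Spaces.linear sM sA P"
  shows "proj_a (in_degree d (op_bracket (Delta_of D) P)) = 0"
  using assms(1)
proof (rule linear_datum_cases)
  fix \<mu> l r P'
  assume D: "D = (\<mu>, l, r, P')" "bilinear_map sA sA sA \<mu>" "bilinear_map sA sM sM l"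
    "bilinear_map sM sA sM r"
  show ?thesis
    by (intro ext)
      (auto simp: proj_a_def in_degree_def op_bracket_def lift_op_def Delta_of_def D Delta_def Y_2
        zero_prod_def bilinear_map_zero[OF D(2)] bilinear_map_zero[OF D(3)] bilinear_map_zero[OF D(4)]
        linear_zero_add[OF assms(2)] split: list.split)
qed

text \<open>The double bracket has nine terms. The three that compose two lifts vanish, and the
  other six group into the two defects.\<close>

lemma proj_a_op_bracket_Delta_twice:
  assumes "linear_datum sA sM D" and "Vector_Spaces.linear sM sA P" and "Vector_Spaces.linear sM sA Q"
  shows "proj_a (in_degree d (op_bracket (op_bracket (Delta_of D) P) Q)) =
    in_degree d (averaging_defect (Delta_of D) P Q + averaging_defect (Delta_of D) Q P)"
  using assms(1)
proof (rule linear_datum_cases)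
  fix \<mu> l r P'
  assume D: "D = (\<mu>, l, r, P')" "bilinear_map sA sA sA \<mu>" "bilinear_map sA sM sM l"
    "bilinear_map sM sA sM r"
  show ?thesis
    by (intro ext)
      (auto simp: proj_a_def in_degree_def op_bracket_def averaging_defect_def
        lift_op_def Delta_of_def D Delta_def Y_2
        zero_prod_def bilinear_map_zero[OF D(2)] bilinear_map_zero[OF D(3)] bilinear_map_zero[OF D(4)] algebra_simps
        linear_zero_add[OF assms(2)] linear_zero_add[OF assms(3)] split: list.split)
qed


text \<open>With \<open>y_left\<close> and \<open>y_right\<close> indexing the two products, the
  five trees of \<open>Y 3\<close> give the five axioms of a diassociative algebra when
  \<open>f = g\<close>.\<close>

definition dialgebra_associator :: "'d::ab_group_add cochain \<Rightarrow> 'd cochain \<Rightarrow> 'd cochain"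
  where "dialgebra_associator f g = circ 2 2 1 f g - circ 2 2 2 f g"

text \<open>
  The operations \<open>l\<^sub>2\<close> and \<open>l\<^sub>3\<close> in degree \<open>0\<close> are the full symmetrisations of the next two maps,
  without a factor \<open>1 / k!\<close>.
\<close>

definition quadratic_part :: "('a::ab_group_add, 'm::ab_group_add) datum \<Rightarrow> ('a, 'm) datum \<Rightarrow> ('a, 'm) Lelem"
  where "quadratic_part D1 D2 =
    (- desusp (in_degree 2 (dialgebra_associator (Delta_of D1) (Delta_of D2))), 0)"

definition cubic_part ::
  "('a::ab_group_add, 'm::ab_group_add) datum \<Rightarrow> ('a, 'm) datum \<Rightarrow> ('a, 'm) datum \<Rightarrow> ('a, 'm) Lelem"
  where "cubic_part D1 D2 D3 =
    (0, in_degree 1 (averaging_defect (Delta_of D1) (op_of D2) (op_of D3)))"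

section \<open>Values of the operations on structure elements\<close>

lemma L_component_element_of:
  "L_component d (element_of D) = (if d = 0 then element_of D else 0)"
  by (auto simp: L_component_def element_of_def desusp_def in_degree_def zero_prod_def fun_eq_iff)

lemma element_of_eq_0:
  assumes "element_of D = 0"
  shows "Delta_of D = 0" "op_of D = 0"
proof -
  from assms show "Delta_of D = 0"
    by (simp add: element_of_def zero_prod_def)
  from assms have *: "operator_cochain (op_of D) = 0"
    by (simp add: element_of_def zero_prod_def)
  show "op_of D = 0"
  proof
    fix u
    from * have "operator_cochain (op_of D) y_one [(0, u)] = 0"
      by simp
    then show "op_of D u = 0 u"
      by (simp add: lift_op_def zero_prod_def)
  qed
qed

lemma l_homogeneous_elements:
  assumes "\<forall>D\<in>set Ds. linear_datum sA sM D" and "length Ds \<ge> 2"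
  shows "l_homogeneous (replicate (length Ds) 0) (map element_of Ds) =
    (if length Ds = 2
     then (- desusp (in_degree 2 (MM_bracket 2 2 (Delta_of (Ds ! 0)) (Delta_of (Ds ! 1)))), 0)
     else 0) +
    (\<Sum>i<length Ds. (0, proj_a (in_degree 1
       (foldl op_bracket (Delta_of (Ds ! i)) (map op_of (take i Ds @ drop (Suc i) Ds))))))"
proof -
  have foldl_eq: "foldl bracket (susp (fst (map element_of Ds ! i)))
        (map snd (take i (map element_of Ds) @ drop (Suc i) (map element_of Ds))) =
      in_degree 1 (foldl op_bracket (Delta_of (Ds ! i)) (map op_of (take i Ds @ drop (Suc i) Ds)))"
    if "i < length Ds" for i
  proof -
    have "map snd (take i (map element_of Ds) @ drop (Suc i) (map element_of Ds)) =
        map (\<lambda>P. in_degree 0 (operator_cochain P)) (map op_of (take i Ds @ drop (Suc i) Ds))"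
      by (simp add: take_map drop_map element_of_def comp_def)
    moreover have "susp (fst (map element_of Ds ! i)) = in_degree 1 (Delta_of (Ds ! i))"
      using that by (simp add: element_of_def)
    moreover have "normalized (Delta_of (Ds ! i))"
      using that assms(1) by (auto intro: normalized_Delta_of)
    moreover have "\<forall>P\<in>set (map op_of (take i Ds @ drop (Suc i) Ds)). P 0 = 0"
      using assms(1) by (auto dest!: in_set_takeD in_set_dropD intro: op_of_zero)
    ultimately show ?thesis
      using foldl_bracket_operator_cochain by metis
  qed
  have quadratic: "bracket (susp (fst (map element_of Ds ! 0))) (susp (fst (map element_of Ds ! 1))) =
      in_degree 2 (MM_bracket 2 2 (Delta_of (Ds ! 0)) (Delta_of (Ds ! 1)))"
  proof -
    have "0 < length Ds" "1 < length Ds"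
      using assms(2) by linarith+
    then have "normalized (Delta_of (Ds ! 0))" "normalized (Delta_of (Ds ! 1))"
      using assms(1) by (blast intro: normalized_Delta_of nth_mem)+
    from bracket_in_degree[OF this, of 1 1] show ?thesis
      using \<open>0 < length Ds\<close> \<open>1 < length Ds\<close> by (simp add: element_of_def numeral_2_eq_2)
  qed
  \<comment> \<open>All arguments have degree 0, so the Koszul signs are trivial.\<close>
  have degree_sum: "sum_list (take i (replicate (length Ds) (0::int))) = 0" for i
    by (simp add: sum_list_replicate)
  have sum_eq: "(\<Sum>i<length Ds. (0,
        sgn_mult (replicate (length Ds) 0 ! i * sum_list (take i (replicate (length Ds) (0::int))))
          (proj_a (foldl bracket (susp (fst (map element_of Ds ! i)))
              (map snd (take i (map element_of Ds) @ drop (Suc i) (map element_of Ds))))))) =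
    (\<Sum>i<length Ds. (0, proj_a (in_degree 1
       (foldl op_bracket (Delta_of (Ds ! i)) (map op_of (take i Ds @ drop (Suc i) Ds))))))"
    by (intro sum.cong refl)
      (simp only: foldl_eq lessThan_iff degree_sum mult_zero_right sgn_mult_def even_zero if_True)
  \<comment> \<open>The exponent is \<open>|f| = 1\<close> for a cochain whose desuspension has
    degree 0; this is the minus sign in \<open>quadratic_part\<close>.\<close>
  have sgn: "sgn_mult (replicate (length Ds) 0 ! 0 + (1::int)) X = - X" for X :: "('a \<times> 'b) gcochain"
  proof -
    have "replicate (length Ds) 0 ! 0 = (0::int)"
      using assms(2) by (intro nth_replicate) linarith
    then show ?thesis
      by (simp add: sgn_mult_def)
  qed
  show ?thesis
    unfolding l_homogeneous_def length_map sum_eq sgn quadratic using assms(2) by simp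
qed

text \<open>\<open>l_ops\<close> sums over nonzero components only. If all arguments are nonzero,
  the single list of degrees is constantly 0; if one is zero, the sum is empty, and the right-hand
  side has to be shown to vanish separately.\<close>

lemma l_ops_elements:
  assumes "\<forall>D\<in>set Ds. linear_datum sA sM D"
  shows "l_ops (map element_of Ds) = l_homogeneous (replicate (length Ds) 0) (map element_of Ds)"
proof (cases "\<exists>D\<in>set Ds. element_of D = 0")
  case False
  then have "L_component d (element_of (Ds ! i)) \<noteq> 0 \<longleftrightarrow> d = 0" if "i < length Ds" for d i
    using that by (simp add: L_component_element_of)
  then have "{ds. length ds = length (map element_of Ds) \<and>
      (\<forall>i<length (map element_of Ds). L_component (ds ! i) (map element_of Ds ! i) \<noteq> 0)} =
    {replicate (length Ds) 0}"
    by (auto simp: list_eq_iff_nth_eq)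
  moreover have "map2 L_component (replicate (length Ds) 0) (map element_of Ds) = map element_of Ds"
    by (simp add: list_eq_iff_nth_eq L_component_element_of)
  ultimately show ?thesis
    by (simp add: l_ops_def)
next
  case True
  then obtain j where j: "j < length Ds" "element_of (Ds ! j) = 0"
    by (auto simp: in_set_conv_nth)
  then have "{ds. length ds = length (map element_of Ds) \<and>
      (\<forall>i<length (map element_of Ds). L_component (ds ! i) (map element_of Ds ! i) \<noteq> 0)} = {}"
    by (auto simp: L_component_element_of intro!: exI[of _ j])
  then have "l_ops (map element_of Ds) = 0"
    unfolding l_ops_def by (simp only: sum.empty)
  moreover have "l_homogeneous (replicate (length Ds) 0) (map element_of Ds) = 0"
  proof (cases "length Ds \<ge> 2")
    case ge_2: True
    have zeros: "\<forall>P\<in>set (map op_of (take i Ds @ drop (Suc i) Ds)). P 0 = 0" for i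
      using assms by (auto dest!: in_set_takeD in_set_dropD intro: op_of_zero)
    have "foldl op_bracket (Delta_of (Ds ! i)) (map op_of (take i Ds @ drop (Suc i) Ds)) = 0"
      if "i < length Ds" for i
    \<comment> \<open>The zero datum supplies either the binary cochain or one of the operators
      bracketed with it.\<close>
    proof (cases "i = j")
      case True
      then show ?thesis
        using element_of_eq_0(1)[OF j(2)] foldl_op_bracket_zero[OF zeros[of i]] by simp
    next
      case False
      have "Ds ! j \<in> set (take i Ds @ drop (Suc i) Ds)"
      proof (cases "j < i")
        case True
        then have "Ds ! j = take i Ds ! j" "j < length (take i Ds)"
          using j(1) by auto
        then show ?thesis
          by (metis Un_iff nth_mem set_append)
      next
        case False
        with \<open>i \<noteq> j\<close> have "Ds ! j = drop (Suc i) Ds ! (j - Suc i)" "j - Suc i < length (drop (Suc i) Ds)"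
          using j(1) by auto
        then show ?thesis
          by (metis Un_iff nth_mem set_append)
      qed
      then have "0 \<in> set (map op_of (take i Ds @ drop (Suc i) Ds))"
        using element_of_eq_0(2)[OF j(2)] by (metis imageI set_map)
      moreover have "normalized (Delta_of (Ds ! i))"
        using that assms(1) by (auto intro: normalized_Delta_of)
      ultimately show ?thesis
        using zeros foldl_op_bracket_zero_mem by blast
    qed
    moreover have "MM_bracket 2 2 (Delta_of (Ds ! 0)) (Delta_of (Ds ! 1)) = 0" if "length Ds = 2"
    proof -
      have "j = 0 \<or> j = 1"
        using that j(1) by auto
      moreover have "normalized (Delta_of (Ds ! 0))" "normalized (Delta_of (Ds ! 1))"
        using assms that by (auto intro!: normalized_Delta_of)
      ultimately show ?thesis
        using element_of_eq_0(1)[OF j(2)] MM_bracket_zero_left MM_bracket_zero_right by metis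
    qed
    ultimately show ?thesis
      unfolding l_homogeneous_elements[OF assms ge_2]
      by (simp flip: zero_prod_def)
  qed (simp add: l_homogeneous_def)
  ultimately show ?thesis
    by simp
qed

lemma l_ops_2:
  assumes "linear_datum sA sM D1" and "linear_datum sA sM D2"
  shows "l_ops [element_of D1, element_of D2] = quadratic_part D1 D2 + quadratic_part D2 D1"
proof -
  have "l_ops (map element_of [D1, D2]) =
    l_homogeneous (replicate (length [D1, D2]) 0) (map element_of [D1, D2])"
    by (rule l_ops_elements) (use assms in simp)
  also have "\<dots> = (- desusp (in_degree 2 (MM_bracket 2 2 (Delta_of D1) (Delta_of D2))), 0)"
    by (subst l_homogeneous_elements[where sA = sA and sM = sM])
      (use assms in \<open>simp_all add: numeral_2_eq_2 proj_a_op_bracket_Delta op_of_linear zero_prod_def\<close>)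
  also have "\<dots> = quadratic_part D1 D2 + quadratic_part D2 D1"
    by (simp add: MM_bracket_2_2 quadratic_part_def dialgebra_associator_def in_degree_add desusp_add)
  finally show ?thesis
    by simp
qed

text \<open>Three choices of the argument that supplies \<open>Delta\<close>, times two orders of
  the remaining operators.\<close>

lemma l_ops_3:
  assumes "linear_datum sA sM D1" and "linear_datum sA sM D2" and "linear_datum sA sM D3"
  shows "l_ops [element_of D1, element_of D2, element_of D3] =
    cubic_part D1 D2 D3 + cubic_part D1 D3 D2 + cubic_part D2 D1 D3 + cubic_part D2 D3 D1
    + cubic_part D3 D1 D2 + cubic_part D3 D2 D1"
proof -
  have "l_ops (map element_of [D1, D2, D3]) =
    l_homogeneous (replicate (length [D1, D2, D3]) 0) (map element_of [D1, D2, D3])"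
    by (rule l_ops_elements) (use assms in simp)
  also have "\<dots> = cubic_part D1 D2 D3 + cubic_part D1 D3 D2 + cubic_part D2 D1 D3 + cubic_part D2 D3 D1
    + cubic_part D3 D1 D2 + cubic_part D3 D2 D1"
    by (subst l_homogeneous_elements[where sA = sA and sM = sM])
      (use assms in \<open>simp_all add: proj_a_op_bracket_Delta_twice op_of_linear
          cubic_part_def in_degree_add\<close>)
  finally show ?thesis
    by simp
qed

text \<open>With at least four arguments, at least three operators are bracketed into one
  \<open>Delta\<close>; below two arguments the operations are zero by definition.\<close>

lemma l_ops_otherwise:
  assumes "\<forall>D\<in>set Ds. linear_datum sA sM D" and "length Ds \<noteq> 2" and "length Ds \<noteq> 3"
  shows "l_ops (map element_of Ds) = 0"
proof (cases "length Ds \<ge> 2")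
  case True
  with assms(2,3) have len: "length Ds \<ge> 4"
    by linarith
  have "foldl op_bracket (Delta_of (Ds ! i)) (map op_of (take i Ds @ drop (Suc i) Ds)) = 0"
    if "i < length Ds" for i
  proof (rule foldl_op_bracket_ge_3)
    show "linear_datum sA sM (Ds ! i)"
      using that assms(1) by simp
    show "\<forall>P\<in>set (map op_of (take i Ds @ drop (Suc i) Ds)). Vector_Spaces.linear sM sA P"
      using assms(1) by (auto dest!: in_set_takeD in_set_dropD intro: op_of_linear)
    show "3 \<le> length (map op_of (take i Ds @ drop (Suc i) Ds))"
      using len that by simp
  qed
  then show ?thesis
    unfolding l_ops_elements[OF assms(1)] l_homogeneous_elements[OF assms(1) True]
    using assms(2) by (simp flip: zero_prod_def)
next
  case False
  then show ?thesis
    unfolding l_ops_elements[OF assms(1)] by (simp add: l_homogeneous_def)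
qed


section \<open>Scalars, and additivity in each argument\<close>

lemma vector_space_L_scale:
  assumes "vector_space sA" and "vector_space sM"
  shows "vector_space (L_scale sA sM)"
proof -
  interpret A: vector_space sA by fact
  interpret M: vector_space sM by fact
  interpret AM: vector_space_prod sA sM ..
  show ?thesis
    by unfold_locales
      (auto simp: L_scale_def fun_eq_iff prod_eq_iff AM.p.scale_right_distrib AM.p.scale_left_distrib)
qed

text \<open>Equal arguments make the terms of a symmetrisation coincide; these identities cancel the
  repetitions against the factorials.\<close>

lemma (in vector_space)
  fixes x :: 'b
  assumes "(2 :: 'a) \<noteq> 0" and "(3 :: 'a) \<noteq> 0"
  shows scale_half_double: "scale (1 / 2) (x + x) = x"
    and scale_sixth_sextuple: "scale (1 / 6) (x + x + x + x + x + x) = x"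
proof -
  have 6: "(6 :: 'a) \<noteq> 0"
  proof -
    have "(6 :: 'a) = 2 * 3" by simp
    then show ?thesis using assms by (metis mult_eq_0_iff)
  qed
  have "x + x = scale 2 x"
    by (metis one_add_one scale_left_distrib scale_one)
  then show "scale (1 / 2) (x + x) = x"
    using assms by simp
  have "x + x + x + x + x + x = scale (1 + 1 + 1 + 1 + 1 + 1) x"
    by (simp only: scale_left_distrib scale_one)
  also have "\<dots> = scale 6 x"
    by simp
  finally show "scale (1 / 6) (x + x + x + x + x + x) = x"
    using 6 by simp
qed

lemma circ_add_left: "circ m n i (f + f') g = circ m n i f g + circ m n i f' g"
  by (intro ext) (simp add: circ_def)

lemma Delta_of_add:
  "Delta_of (D + D') = Delta_of D + Delta_of D'"
  by (intro ext)
    (auto simp: Delta_of_def Delta_def zero_prod_def split: list.split prod.split)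

lemma op_of_add: "op_of (D + D') = op_of D + op_of D'"
  by (simp add: op_of_def)

lemma Delta_of_biadditive:
  assumes "linear_datum sA sM D"
  shows "Delta_of D y [x + x', z] = Delta_of D y [x, z] + Delta_of D y [x', z]"
    and "Delta_of D y [x, z + z'] = Delta_of D y [x, z] + Delta_of D y [x, z']"
  using assms
  by (auto elim!: linear_datum_cases simp: Delta_of_def Delta_def zero_prod_def bilinear_map_add
      split: prod.split)

text \<open>The value of the inner cochain becomes an input of the outer one, so additivity here
  rests on biadditivity of \<open>Delta_of D\<close>.\<close>

lemma circ_Delta_of_add_right:
  assumes "linear_datum sA sM D" and "i = 1 \<or> i = 2"
  shows "circ 2 2 i (Delta_of D) (g + g') = circ 2 2 i (Delta_of D) g + circ 2 2 i (Delta_of D) g'"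
proof (intro ext)
  fix y and xs :: "('b \<times> 'c) list"
  show "circ 2 2 i (Delta_of D) (g + g') y xs =
    (circ 2 2 i (Delta_of D) g + circ 2 2 i (Delta_of D) g') y xs"
  proof (cases "y \<in> Y 3 \<and> length xs = 3")
    case True
    then obtain x1 x2 x3 where "xs = [x1, x2, x3]"
      by (auto simp: length_eq_3_iff)
    with assms(2) show ?thesis
      by (auto simp: circ_def Delta_of_biadditive[OF assms(1)])
  qed (auto simp: circ_def)
qed

lemma quadratic_part_add:
  assumes "linear_datum sA sM D1" and "linear_datum sA sM D1'"
  shows "quadratic_part (D1 + D1') D2 = quadratic_part D1 D2 + quadratic_part D1' D2"
    and "quadratic_part D1 (D2 + D2') = quadratic_part D1 D2 + quadratic_part D1 D2'"
  by (simp_all add: quadratic_part_def dialgebra_associator_def Delta_of_add circ_add_left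
      circ_Delta_of_add_right[OF assms(1)] algebra_simps flip: desusp_add in_degree_add)

lemma averaging_defect_add:
  assumes "linear_datum sA sM D" and "Vector_Spaces.linear sM sA P"
  shows "averaging_defect (f + f') P R = averaging_defect f P R + averaging_defect f' P R"
    and "averaging_defect (Delta_of D) (P + P') R =
      averaging_defect (Delta_of D) P R + averaging_defect (Delta_of D) P' R"
    and "averaging_defect (Delta_of D) P (Q + Q') =
      averaging_defect (Delta_of D) P Q + averaging_defect (Delta_of D) P Q'"
proof -
  show "averaging_defect (f + f') P R = averaging_defect f P R + averaging_defect f' P R"
    by (intro ext)
      (simp add: averaging_defect_def linear_zero_add[OF assms(2)] zero_prod_def split: list.split)
  have lift: "lift_op (P + P') x = lift_op P x + lift_op P' x" for P P' :: "'c \<Rightarrow> 'b" and x :: "'b \<times> 'c"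
    by (simp add: lift_op_def)
  show "averaging_defect (Delta_of D) (P + P') R =
      averaging_defect (Delta_of D) P R + averaging_defect (Delta_of D) P' R"
    by (intro ext)
      (simp add: averaging_defect_def lift Delta_of_biadditive[OF assms(1)] linear_zero_add[OF assms(2)]
          zero_prod_def split: list.split)
  show "averaging_defect (Delta_of D) P (Q + Q') =
      averaging_defect (Delta_of D) P Q + averaging_defect (Delta_of D) P Q'"
    by (intro ext)
      (simp add: averaging_defect_def lift Delta_of_biadditive[OF assms(1)] linear_zero_add[OF assms(2)]
          zero_prod_def split: list.split)
qed

section \<open>The identities encoded by the two parts, and the curvature\<close>

lemma dialgebra_associator_eq_0_iff:
  assumes "linear_datum sA sM (\<mu>, l, r, P)"
  shows "dialgebra_associator (Delta \<mu> l r) (Delta \<mu> l r) = 0 \<longleftrightarrow>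
    (\<forall>a b c. \<mu> (\<mu> a b) c = \<mu> a (\<mu> b c)) \<and> (\<forall>a b u. l (\<mu> a b) u = l a (l b u)) \<and>
    (\<forall>a u b. r (l a u) b = l a (r u b)) \<and> (\<forall>u a b. r (r u a) b = r u (\<mu> a b))"
  (is "?lhs \<longleftrightarrow> ?rhs")
proof -
  note R = R_out_def R_in_def delete_leaves_def y_left_def y_right_def y_one_def
  \<comment> \<open>Each map deletes one of the leaves 0 to 3: the outer tree loses leaf
    \<open>i\<close>, the inner tree loses leaf 3 for \<open>i = 1\<close> and leaf 0 for
    \<open>i = 2\<close>.\<close>
  have R_values:
    "R_out 2 1 2 (Graft Leaf y_left) = y_left" "R_in 2 1 2 (Graft Leaf y_left) = y_left"
    "R_out 2 2 2 (Graft Leaf y_left) = y_left" "R_in 2 2 2 (Graft Leaf y_left) = y_left"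
    "R_out 2 1 2 (Graft Leaf y_right) = y_left" "R_in 2 1 2 (Graft Leaf y_right) = y_left"
    "R_out 2 2 2 (Graft Leaf y_right) = y_left" "R_in 2 2 2 (Graft Leaf y_right) = y_right"
    "R_out 2 1 2 (Graft y_one y_one) = y_left" "R_in 2 1 2 (Graft y_one y_one) = y_right"
    "R_out 2 2 2 (Graft y_one y_one) = y_right" "R_in 2 2 2 (Graft y_one y_one) = y_left"
    "R_out 2 1 2 (Graft y_left Leaf) = y_right" "R_in 2 1 2 (Graft y_left Leaf) = y_left"
    "R_out 2 2 2 (Graft y_left Leaf) = y_right" "R_in 2 2 2 (Graft y_left Leaf) = y_right"
    "R_out 2 1 2 (Graft y_right Leaf) = y_right" "R_in 2 1 2 (Graft y_right Leaf) = y_right"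
    "R_out 2 2 2 (Graft y_right Leaf) = y_right" "R_in 2 2 2 (Graft y_right Leaf) = y_right"
    by (simp_all add: R)
  have on_list: "dialgebra_associator f f y [x1, x2, x3] =
      (if y \<in> Y 3 then f (R_out 2 1 2 y) [f (R_in 2 1 2 y) [x1, x2], x3]
        - f (R_out 2 2 2 y) [x1, f (R_in 2 2 2 y) [x2, x3]] else 0)"
    for f :: "('b \<times> 'c) cochain" and y x1 x2 x3
    by (simp add: dialgebra_associator_def circ_def)
  have "?lhs \<longleftrightarrow> (\<forall>y\<in>Y 3. \<forall>x1 x2 x3.
      dialgebra_associator (Delta \<mu> l r) (Delta \<mu> l r) y [x1, x2, x3] = 0)" (is "_ \<longleftrightarrow> ?pointwise")
  proof
    assume pointwise: ?pointwise
    show ?lhs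
    proof (intro ext)
      fix y and xs :: "('b \<times> 'c) list"
      show "dialgebra_associator (Delta \<mu> l r) (Delta \<mu> l r) y xs = 0 y xs"
      proof (cases "y \<in> Y 3 \<and> length xs = 3")
        case True
        with pointwise show ?thesis
          by (auto simp: length_eq_3_iff)
      qed (auto simp: dialgebra_associator_def circ_def)
    qed
  qed simp
  also have "\<dots> \<longleftrightarrow> ?rhs"
  proof
    \<comment> \<open>Three trees suffice. They put the module element first, in the middle and
      last, which gives the right, mixed and left bimodule axioms; the first also yields
      associativity. The other two trees repeat the right and left axioms.\<close>
    assume pointwise: ?pointwise
    have 1: "\<mu> (\<mu> a b) c = \<mu> a (\<mu> b c) \<and> r (r u b) c = r u (\<mu> b c)" for a b c u
      using bspec[OF pointwise, of "Graft Leaf y_left",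
          THEN spec, of "(a, u)", THEN spec, of "(b, 0)", THEN spec, of "(c, 0)"]
      by (simp add: on_list Y_3 R_values Delta_def zero_prod_def del: One_nat_def)
    have 2: "r (l a u) c = l a (r u c)" for a c u
      using bspec[OF pointwise, of "Graft y_one y_one",
          THEN spec, of "(a, 0)", THEN spec, of "(0, u)", THEN spec, of "(c, 0)"]
      by (simp add: on_list Y_3 R_values Delta_def zero_prod_def del: One_nat_def)
    have 3: "l (\<mu> a b) u = l a (l b u)" for a b u
      using bspec[OF pointwise, of "Graft y_right Leaf",
          THEN spec, of "(a, 0)", THEN spec, of "(b, 0)", THEN spec, of "(0, u)"]
      by (simp add: on_list Y_3 R_values Delta_def zero_prod_def del: One_nat_def)
    show ?rhs
      using 1 2 3 by blast
  next
    assume eqs: ?rhs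
    show ?pointwise
    proof (intro ballI allI)
      fix y and x1 x2 x3 :: "'b \<times> 'c"
      assume y: "y \<in> Y 3"
      obtain a u b v c w where x: "x1 = (a, u)" "x2 = (b, v)" "x3 = (c, w)"
        by (metis surj_pair)
      from y have on_list': "dialgebra_associator f f y [x1, x2, x3] =
          f (R_out 2 1 2 y) [f (R_in 2 1 2 y) [x1, x2], x3]
          - f (R_out 2 2 2 y) [x1, f (R_in 2 2 2 y) [x2, x3]]" for f :: "('b \<times> 'c) cochain"
        by (simp add: on_list)
      from y[unfolded Y_3] eqs show "dialgebra_associator (Delta \<mu> l r) (Delta \<mu> l r) y [x1, x2, x3] = 0"
        unfolding on_list' unfolding x
        by (elim disjE) (simp_all add: R_values Delta_def zero_prod_def del: One_nat_def)
    qed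
  qed
  finally show ?thesis .
qed

text \<open>\<open>y_left\<close> carries the right action and \<open>y_right\<close> the left one.
  On each tree one of the two subtracted terms is zero, so each tree yields one of the two averaging
  identities.\<close>

lemma averaging_defect_eq_0_iff:
  assumes "linear_datum sA sM (\<mu>, l, r, P)"
  shows "averaging_defect (Delta \<mu> l r) P P = 0 \<longleftrightarrow>
    (\<forall>u v. \<mu> (P u) (P v) = P (l (P u) v) \<and> \<mu> (P u) (P v) = P (r u (P v)))"
  (is "?lhs \<longleftrightarrow> ?rhs")
proof -
  have lin: "Vector_Spaces.linear sM sA P" "bilinear_map sA sM sM l" "bilinear_map sM sA sM r"
    using assms by (simp_all add: linear_datum_def)
  have on_list: "averaging_defect (Delta \<mu> l r) P P y [x, z] =
      (if y = y_left then (\<mu> (P (snd x)) (P (snd z)) - P (r (snd x) (P (snd z))), 0)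
       else if y = y_right then (\<mu> (P (snd x)) (P (snd z)) - P (l (P (snd x)) (snd z)), 0)
       else 0)" for y x z
    by (simp add: averaging_defect_def Delta_def lift_op_def Y_2 bilinear_map_zero[OF lin(2)]
        bilinear_map_zero[OF lin(3)] linear_zero_add[OF lin(1)])
  have "?lhs \<longleftrightarrow> (\<forall>y x z. averaging_defect (Delta \<mu> l r) P P y [x, z] = 0)" (is "_ \<longleftrightarrow> ?pointwise")
  proof
    assume pointwise: ?pointwise
    show ?lhs
    proof (intro ext)
      fix y and xs :: "('b \<times> 'c) list"
      show "averaging_defect (Delta \<mu> l r) P P y xs = 0 y xs"
      proof (cases "length xs = 2")
        case True
        with pointwise show ?thesis
          by (auto simp: length_eq_2_iff)
      qed (auto simp: averaging_defect_def split: list.split)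
    qed
  qed simp
  also have "\<dots> \<longleftrightarrow> ?rhs"
  proof
    assume pointwise: ?pointwise
    show ?rhs
    proof (intro allI conjI)
      fix u v
      show "\<mu> (P u) (P v) = P (l (P u) v)"
        using pointwise[THEN spec, of y_right, THEN spec, of "(0, u)", THEN spec, of "(0, v)"]
        by (simp add: on_list zero_prod_def)
      show "\<mu> (P u) (P v) = P (r u (P v))"
        using pointwise[THEN spec, of y_left, THEN spec, of "(0, u)", THEN spec, of "(0, v)"]
        by (simp add: on_list zero_prod_def)
    qed
  next
    assume ?rhs
    then have "P (l (P u) v) = \<mu> (P u) (P v)" "P (r u (P v)) = \<mu> (P u) (P v)" for u v
      by metis+
    then show ?pointwise
      by (simp add: on_list zero_prod_def)
  qed
  finally show ?thesis .
qed


lemma cubic_part_add: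
  assumes "linear_datum sA sM D1" and "linear_datum sA sM D2"
  shows "cubic_part (D1 + D1') D2 D3 = cubic_part D1 D2 D3 + cubic_part D1' D2 D3"
    and "cubic_part D1 (D2 + D2') D3 = cubic_part D1 D2 D3 + cubic_part D1 D2' D3"
    and "cubic_part D1 D2 (D3 + D3') = cubic_part D1 D2 D3 + cubic_part D1 D2 D3'"
  using averaging_defect_add[OF assms(1) op_of_linear[OF assms(2)]]
  by (simp_all add: cubic_part_def Delta_of_add op_of_add in_degree_add)

definition curvature :: "('a::ab_group_add, 'm::ab_group_add) datum \<Rightarrow> ('a, 'm) Lelem"
  where "curvature D = quadratic_part D D + cubic_part D D D"

lemma curvature_eq_0_iff:
  assumes "vector_space sA" and "vector_space sM" and "linear_datum sA sM (\<mu>, l, r, P)"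
  shows "curvature (\<mu>, l, r, P) = 0 \<longleftrightarrow>
    associative_algebra sA \<mu> \<and> bimodule sA sM \<mu> l r \<and> relative_averaging_operator sA sM \<mu> l r P"
proof -
  have "curvature (\<mu>, l, r, P) = 0 \<longleftrightarrow>
      dialgebra_associator (Delta \<mu> l r) (Delta \<mu> l r) = 0 \<and> averaging_defect (Delta \<mu> l r) P P = 0"
    by (simp add: curvature_def quadratic_part_def cubic_part_def Delta_of_def op_of_def zero_prod_def)
  also have "\<dots> \<longleftrightarrow>
    associative_algebra sA \<mu> \<and> bimodule sA sM \<mu> l r \<and> relative_averaging_operator sA sM \<mu> l r P"
    unfolding dialgebra_associator_eq_0_iff[OF assms(3)] averaging_defect_eq_0_iff[OF assms(3)]
    using assms(3)
    by (auto simp: linear_datum_def associative_algebra_def bimodule_def relative_averaging_operator_def)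
  finally show ?thesis .
qed

lemma linear_add:
  assumes "Vector_Spaces.linear s1 s2 f" and "Vector_Spaces.linear s1 s2 g"
  shows "Vector_Spaces.linear s1 s2 (f + g)"
proof -
  interpret vector_space s2
    using assms(1) by (simp add: Vector_Spaces.linear_iff)
  show ?thesis
    using assms by (simp add: Vector_Spaces.linear_iff scale_right_distrib algebra_simps)
qed

lemma bilinear_map_sum:
  assumes "bilinear_map sU sV sW \<phi>" and "bilinear_map sU sV sW \<psi>"
  shows "bilinear_map sU sV sW (\<phi> + \<psi>)"
  using assms linear_add[of sV sW "\<phi> u" "\<psi> u" for u]
    linear_add[of sU sW "\<lambda>u. \<phi> u v" "\<lambda>u. \<psi> u v" for v]
  by (simp add: bilinear_map_def plus_fun_def)

lemma linear_datum_add: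
  "linear_datum sA sM D \<Longrightarrow> linear_datum sA sM D' \<Longrightarrow> linear_datum sA sM (D + D')"
  by (auto simp: linear_datum_def linear_add bilinear_map_sum split: prod.splits)

section \<open>Bidegrees of the cochains, and membership in degree 0\<close>

lemma mixed_length: "xs \<in> mixed k l \<Longrightarrow> int (length xs) = k + l"
  by (auto simp: mixed_def)

lemma mixed_singleton:
  assumes "[x] \<in> mixed k l"
  shows "k = 1 \<and> l = 0 \<and> x \<in> A_part \<or> k = 0 \<and> l = 1 \<and> x \<in> M_part"
proof -
  obtain S where S: "S \<subseteq> {0::nat}" "int (card S) = k" "1 = k + l"
      "x \<in> (if 0 \<in> S then A_part else M_part)"
    using assms by (auto simp: mixed_def lessThan_Suc)
  from S(1) consider "S = {}" | "S = {0}"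
    by auto
  then show ?thesis
    using S by cases auto
qed

lemma mixed_pair:
  assumes "[x, z] \<in> mixed k l"
  shows "k = 2 \<and> l = 0 \<and> x \<in> A_part \<and> z \<in> A_part \<or>
    k = 1 \<and> l = 1 \<and> (x \<in> A_part \<and> z \<in> M_part \<or> x \<in> M_part \<and> z \<in> A_part) \<or>
    k = 0 \<and> l = 2 \<and> x \<in> M_part \<and> z \<in> M_part"
proof -
  obtain S where S: "S \<subseteq> {0, 1::nat}" "int (card S) = k" "2 = k + l"
      "x \<in> (if 0 \<in> S then A_part else M_part)" "z \<in> (if 1 \<in> S then A_part else M_part)"
    using assms by (auto simp: mixed_def lessThan_Suc all_conj_distrib less_Suc_eq insert_commute)
  from S(1) consider "S = {}" | "S = {0}" | "S = {1}" | "S = {0, 1}"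
    by blast
  then show ?thesis
    using S by cases auto
qed

lemma Delta_in_h_space:
  assumes "vector_space sA" and "vector_space sM" and "linear_datum sA sM (\<mu>, l, r, P)"
  shows "Delta \<mu> l r \<in> h_space sA sM 1"
proof -
  interpret A: vector_space sA by fact
  interpret M: vector_space sM by fact
  interpret AM: vector_space_prod sA sM ..
  have \<mu>: "bilinear_map sA sA sA \<mu>" and l: "bilinear_map sA sM sM l" and r: "bilinear_map sM sA sM r"
    using assms(3) by (simp_all add: linear_datum_def)
  note zero = bilinear_map_zero[OF \<mu>] bilinear_map_zero[OF l] bilinear_map_zero[OF r]
  have lin: "Vector_Spaces.linear AM.scale AM.scale (\<lambda>v. Delta \<mu> l r y (xs[i := v]))"
    if y: "y \<in> Y 2" and xs: "length xs = 2" and i: "i < 2" for y xs i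
  proof -
    obtain x z where "xs = [x, z]"
      using xs by (auto simp: length_eq_2_iff)
    moreover have "i = 0 \<or> i = 1"
      using i by auto
    ultimately show ?thesis
      using y \<mu> l r
      by (auto simp: Y_2 Vector_Spaces.linear_iff AM.p.vector_space_axioms Delta_def AM.scale_def
          bilinear_map_def split: prod.split)
  qed
  have "Delta \<mu> l r \<in> CY AM.scale 2"
    using lin by (auto simp: CY_def Y_2 Delta_def split: list.split)
  \<comment> \<open>Bidegree \<open>1|0\<close>: the unwanted components are products with a zero
    factor, and two inputs from M leave every product with such a factor.\<close>
  moreover have "Delta \<mu> l r y xs \<in> A_part" if "xs \<in> mixed 2 0" for y xs
    using that mixed_length[OF that]
    by (auto simp: length_eq_2_iff A_part_def Delta_def zero zero_prod_def dest!: mixed_pair)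
  moreover have "Delta \<mu> l r y xs \<in> M_part" if "xs \<in> mixed 1 1" for y xs
    using that mixed_length[OF that]
    by (auto simp: length_eq_2_iff A_part_def M_part_def Delta_def zero zero_prod_def dest!: mixed_pair)
  moreover have "Delta \<mu> l r y xs = 0"
    if "xs \<in> mixed k' l'" "(k', l') \<noteq> (2, 0)" "(k', l') \<noteq> (1, 1)" for y xs k' l'
  proof (cases "length xs = 2")
    case True
    with that show ?thesis
      by (auto simp: length_eq_2_iff M_part_def Delta_def zero zero_prod_def dest!: mixed_pair)
  qed (auto simp: Delta_def split: list.split)
  ultimately show ?thesis
    by (simp add: h_space_def CY_bideg_def)
qed

lemma operator_cochain_in_a_space:
  assumes "vector_space sA" and "vector_space sM" and "Vector_Spaces.linear sM sA P"
  shows "operator_cochain P \<in> a_space sA sM 0"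
proof -
  interpret A: vector_space sA by fact
  interpret M: vector_space sM by fact
  interpret AM: vector_space_prod sA sM ..
  note P = linear_zero_add(1)[OF assms(3)]
  have "Vector_Spaces.linear AM.scale AM.scale (\<lambda>v. operator_cochain P y (xs[0 := v]))"
    if y: "y \<in> Y 1" and xs: "length xs = 1" for y xs
  proof -
    obtain x where "xs = [x]"
      using xs by (auto simp: length_Suc_conv)
    then show ?thesis
      using y assms(3)
      by (auto simp: Y_1 Vector_Spaces.linear_iff AM.p.vector_space_axioms lift_op_def AM.scale_def)
  qed
  then have "operator_cochain P \<in> CY AM.scale 1"
    by (auto simp: CY_def Y_1 operator_cochain_def split: list.split)
  moreover have "operator_cochain P y xs \<in> A_part" if "xs \<in> mixed 0 1" for y xs
    using mixed_length[OF that] by (auto simp: length_Suc_conv A_part_def lift_op_def)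
  \<comment> \<open>Vacuous: no set of positions has cardinality -1.\<close>
  moreover have "operator_cochain P y xs \<in> M_part" if "xs \<in> mixed (- 1) 2" for y xs
    using that mixed_length[OF that] by (auto simp: length_Suc_conv dest!: mixed_singleton)
  moreover have "operator_cochain P y xs = 0"
    if "xs \<in> mixed k' l'" "(k', l') \<noteq> (0, 1)" for y xs k' l'
  proof (cases "length xs = 1")
    case True
    with that show ?thesis
      by (auto simp: length_Suc_conv A_part_def lift_op_def P zero_prod_def dest!: mixed_singleton)
  qed (auto simp: operator_cochain_def split: list.split)
  ultimately show ?thesis
    by (simp add: a_space_def CY_bideg_def)
qed

lemma element_of_in_L_degree:
  assumes "vector_space sA" and "vector_space sM" and "linear_datum sA sM D"
  shows "element_of D \<in> L_degree sA sM 0"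
proof -
  have "Delta_of D \<in> h_space sA sM (0 + 1)"
    using Delta_in_h_space[OF assms(1,2)] assms(3) by (cases D) (simp add: Delta_of_def)
  moreover have "operator_cochain (op_of D) \<in> a_space sA sM 0"
    using operator_cochain_in_a_space[OF assms(1,2)] assms(3) by (simp add: op_of_linear)
  ultimately show ?thesis
    unfolding L_degree_def element_of_def by force
qed

section \<open>Twisting and the Maurer-Cartan equation\<close>

lemma twisted_elements:
  fixes sA :: "'k::field_char_0 \<Rightarrow> 'a::ab_group_add \<Rightarrow> 'a"
    and sM :: "'k \<Rightarrow> 'm::ab_group_add \<Rightarrow> 'm"
  assumes "vector_space sA" and "vector_space sM" and "linear_datum sA sM D" and "linear_datum sA sM D'"
    and "k \<ge> 1"
  shows "twisted (L_scale sA sM) l_ops (element_of D) (replicate k (element_of D')) =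
    l_ops (replicate k (element_of D')) + l_ops (element_of D # replicate k (element_of D')) +
    L_scale sA sM (1 / 2) (l_ops (element_of D # element_of D # replicate k (element_of D')))"
proof -
  interpret L: vector_space "L_scale sA sM"
    by (rule vector_space_L_scale) fact+
  \<comment> \<open>As \<open>k \<ge> 1\<close>, three copies of the twisting element already make
    at least four arguments, so only \<open>n = 0, 1, 2\<close> survive.\<close>
  have vanish: "l_ops (replicate n (element_of D) @ replicate k (element_of D')) = 0" if "n \<ge> 3" for n
  proof -
    have "l_ops (map element_of (replicate n D @ replicate k D')) = 0"
      by (rule l_ops_otherwise[where sA = sA and sM = sM]) (use assms(3-5) that in auto)
    then show ?thesis
      by simp
  qed
  have "twisted (L_scale sA sM) l_ops (element_of D) (replicate k (element_of D')) =
    (\<Sum>n\<in>{0, 1, 2}. L_scale sA sM (1 / fact n) 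
      (l_ops (replicate n (element_of D) @ replicate k (element_of D'))))"
    unfolding twisted_def
  proof (intro Sum_any.expand_superset subsetI)
    fix n
    assume "n \<in> {n. L_scale sA sM (1 / fact n)
        (l_ops (replicate n (element_of D) @ replicate k (element_of D'))) \<noteq> 0}"
    then have "\<not> n \<ge> 3"
      using vanish by auto
    then have "n = 0 \<or> n = 1 \<or> n = 2"
      by linarith
    then show "n \<in> {0, 1, 2}"
      by simp
  qed simp
  then show ?thesis
    by (simp add: numeral_2_eq_2 algebra_simps)
qed

lemma maurer_cartan_twisted_iff:
  fixes sA :: "'k::field_char_0 \<Rightarrow> 'a::ab_group_add \<Rightarrow> 'a"
    and sM :: "'k \<Rightarrow> 'm::ab_group_add \<Rightarrow> 'm"
  assumes "vector_space sA" and "vector_space sM" and D: "linear_datum sA sM D" and D': "linear_datum sA sM D'"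
  shows "maurer_cartan (L_scale sA sM) (L_degree sA sM 0)
      (twisted (L_scale sA sM) l_ops (element_of D)) (element_of D') \<longleftrightarrow>
    curvature (D + D') = curvature D"
proof -
  interpret L: vector_space "L_scale sA sM"
    by (rule vector_space_L_scale) fact+
  let ?s = "L_scale sA sM" and ?\<alpha> = "element_of D" and ?\<beta> = "element_of D'"
  let ?t = "\<lambda>k. ?s (1 / fact k) (twisted ?s l_ops ?\<alpha> (replicate k ?\<beta>))"
  note twisted = twisted_elements[OF assms]
  have l_ops_0: "l_ops (replicate n ?\<alpha> @ replicate k ?\<beta>) = 0" if "n + k \<noteq> 2" "n + k \<noteq> 3" for n k
  proof -
    have "l_ops (map element_of (replicate n D @ replicate k D')) = 0"
      by (rule l_ops_otherwise[where sA = sA and sM = sM]) (use D D' that in auto)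
    then show ?thesis
      by simp
  qed
  have large: "?t k = 0" if "k \<ge> 4" for k
    using that l_ops_0[of 0 k] l_ops_0[of 1 k] l_ops_0[of 2 k] by (simp add: twisted numeral_2_eq_2)
  have sub: "{k. k \<ge> 1 \<and> ?t k \<noteq> 0} \<subseteq> {1, 2, 3}"
  proof
    fix k
    assume "k \<in> {k. k \<ge> 1 \<and> ?t k \<noteq> 0}"
    then have "k \<ge> 1" "\<not> k \<ge> 4"
      using large by blast+
    then have "k = 1 \<or> k = 2 \<or> k = 3"
      by linarith
    then show "k \<in> {1, 2, 3}"
      by simp
  qed
  then have "(\<Sum>k | k \<ge> 1 \<and> ?t k \<noteq> 0. ?t k) = (\<Sum>k\<in>{1, 2, 3}. ?t k)"
    by (intro sum.mono_neutral_left) auto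
  also have "\<dots> = ?t 1 + ?t 2 + ?t 3"
    by (simp add: add.assoc)
  \<comment> \<open>The summand \<open>?t k\<close> collects the terms of degree \<open>k\<close> in
    \<open>?\<beta>\<close>; only those with two or three arguments in total remain.\<close>
  also have "?t 1 = l_ops [?\<alpha>, ?\<beta>] + ?s (1 / 2) (l_ops [?\<alpha>, ?\<alpha>, ?\<beta>])"
    using l_ops_0[of 0 1] twisted[of 1] by simp
  also have "?t 2 = ?s (1 / 2) (l_ops [?\<beta>, ?\<beta>]) + ?s (1 / 2) (l_ops [?\<alpha>, ?\<beta>, ?\<beta>])"
    using l_ops_0[of 2 2] twisted[of 2] by (simp add: numeral_2_eq_2 L.scale_right_distrib)
  also have "?t 3 = ?s (1 / 6) (l_ops [?\<beta>, ?\<beta>, ?\<beta>])"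
    using l_ops_0[of 1 3] l_ops_0[of 2 3] twisted[of 3] by (simp add: numeral_3_eq_3 numeral_2_eq_2)
  also have "l_ops [?\<alpha>, ?\<beta>] = quadratic_part D D' + quadratic_part D' D"
    using D D' by (rule l_ops_2)
  also have "?s (1 / 2) (l_ops [?\<beta>, ?\<beta>]) = quadratic_part D' D'"
    unfolding l_ops_2[OF D' D'] by (rule L.scale_half_double) simp_all
  \<comment> \<open>One repeated argument makes each of three distinct terms occur twice among the
    six, which absorbs the factor 1/2.\<close>
  also have "?s (1 / 2) (l_ops [?\<alpha>, ?\<alpha>, ?\<beta>]) = cubic_part D D D' + cubic_part D D' D + cubic_part D' D D"
    unfolding l_ops_3[OF D D D']
    by (subst L.scale_half_double[symmetric]) (simp_all add: algebra_simps)
  also have "?s (1 / 2) (l_ops [?\<alpha>, ?\<beta>, ?\<beta>]) = cubic_part D D' D' + cubic_part D' D D' + cubic_part D' D' D"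
    unfolding l_ops_3[OF D D' D']
    by (subst L.scale_half_double[symmetric]) (simp_all add: algebra_simps)
  also have "?s (1 / 6) (l_ops [?\<beta>, ?\<beta>, ?\<beta>]) = cubic_part D' D' D'"
    unfolding l_ops_3[OF D' D' D'] by (rule L.scale_sixth_sextuple) simp_all
  finally have "(\<Sum>k | k \<ge> 1 \<and> ?t k \<noteq> 0. ?t k) = curvature (D + D') - curvature D"
    \<comment> \<open>Expanding \<open>curvature (D + D')\<close> gives four quadratic and eight
      cubic terms; subtracting \<open>curvature D\<close> removes the two that involve
      \<open>D\<close> alone. The first slot of \<open>cubic_part\<close> is split while the second
      still holds \<open>D + D'\<close>, whence the instance with
      \<open>linear_datum_add\<close>.\<close>
    by (simp add: curvature_def quadratic_part_add[OF D D'] quadratic_part_add[OF D' D]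
        cubic_part_add(1)[OF D linear_datum_add[OF D D']] cubic_part_add[OF D D]
        cubic_part_add[OF D D'] cubic_part_add[OF D' D] cubic_part_add[OF D' D'] algebra_simps)
  moreover have "finite {k. k \<ge> 1 \<and> ?t k \<noteq> 0}"
    using sub by (rule finite_subset) simp
  moreover have "?\<beta> \<in> L_degree sA sM 0"
    using assms by (blast intro: element_of_in_L_degree)
  ultimately show ?thesis
    unfolding maurer_cartan_def by simp
qed

theorem theorem5p9:
  fixes sA :: "'k::field_char_0 \<Rightarrow> 'a::ab_group_add \<Rightarrow> 'a"
    and sM :: "'k \<Rightarrow> 'm::ab_group_add \<Rightarrow> 'm"
    and \<mu> \<mu>' :: "'a \<Rightarrow> 'a \<Rightarrow> 'a"
    and l l' :: "'a \<Rightarrow> 'm \<Rightarrow> 'm"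
    and r r' :: "'m \<Rightarrow> 'a \<Rightarrow> 'm"
    and P P' :: "'m \<Rightarrow> 'a"
  assumes "vector_space sA" and "vector_space sM"
    and "associative_algebra sA \<mu>"
    and "bimodule sA sM \<mu> l r"
    and "relative_averaging_operator sA sM \<mu> l r P"
    and "bilinear_map sA sA sA \<mu>'"
    and "bilinear_map sA sM sM l'"
    and "bilinear_map sM sA sM r'"
    and "Vector_Spaces.linear sM sA P'"
  shows "associative_algebra sA (\<mu> + \<mu>') \<and>
         bimodule sA sM (\<mu> + \<mu>') (l + l') (r + r') \<and>
         relative_averaging_operator sA sM (\<mu> + \<mu>') (l + l') (r + r') (P + P') \<longleftrightarrow>
         maurer_cartan (L_scale sA sM) (L_degree sA sM 0)
           (twisted (L_scale sA sM) l_ops (structure_element \<mu> l r P))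
           (structure_element \<mu>' l' r' P')"
proof -
  let ?D = "(\<mu>, l, r, P)" and ?D' = "(\<mu>', l', r', P')"
  have D: "linear_datum sA sM ?D" and D': "linear_datum sA sM ?D'"
    using assms(3-9)
    by (simp_all add: linear_datum_def associative_algebra_def bimodule_def relative_averaging_operator_def)
  have "maurer_cartan (L_scale sA sM) (L_degree sA sM 0)
      (twisted (L_scale sA sM) l_ops (structure_element \<mu> l r P)) (structure_element \<mu>' l' r' P') \<longleftrightarrow>
    curvature (?D + ?D') = curvature ?D"
    using maurer_cartan_twisted_iff[OF assms(1,2) D D']
    by (simp add: structure_element_def element_of_def Delta_of_def op_of_def)
  also have "curvature ?D = 0"
    using curvature_eq_0_iff[OF assms(1,2) D] assms(3-5) by blast
  also have "curvature (?D + ?D') = 0 \<longleftrightarrow>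
    associative_algebra sA (\<mu> + \<mu>') \<and> bimodule sA sM (\<mu> + \<mu>') (l + l') (r + r') \<and>
    relative_averaging_operator sA sM (\<mu> + \<mu>') (l + l') (r + r') (P + P')"
    using curvature_eq_0_iff[OF assms(1,2)] linear_datum_add[OF D D'] by simp
  finally show ?thesis
    by blast
qed

end
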